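(* Let $X$ be an extremally disconnected Stone space, $Closed(X)$ the distributive lattice of closed subsets of $X$ and $Clopen(X)$ the (complete) Boolean algebra of clopen subsets of $X$. Then taking interiors defines a lattice homomorphism $int:Closed(X)\to Clopen(X)$, and the resulting coherent functor $$int:Closed(X)\to Clopen(X)\subseteq Sh(Clopen(X),\tau_{\omega-coh})$$ is positively closed. If $X$ is not discrete then it is not strongly positively closed.
   Context: A Stone space is extremally disconnected if the closure of every open set is open (equivalently, the interior of every closed set is clopen). A distributive lattice (with top and bottom) is regarded as a coherent category. $\tau_{\omega-coh}$ is the topology on $B=Clopen(X)$ whose covers of $b$ are the finite families $(b_i\le b)_i$ with $\bigvee_i b_i=b$ (including the empty cover of $\bot$); an element $b\in B$ is identified with its representable sheaf, a subobject of $1$. (Also $Sh(Clopen(X),\tau_{\omega-coh})=Sh(X)$.) For a coherent category $\mathcal{C}$ and a coherent functor $M:\mathcal{C}\to\mathcal{E}$ into a Grothendieck topos: $M$ is positively closed if for every coherent functor $N:\mathcal{C}\to\mathcal{E}$, every natural transformation $M\Rightarrow N$ is elementary, i.e. its naturality squares at monomorphisms of $\mathcal{C}$ are pullbacks; $M$ is strongly positively closed if for every mono $u\hookrightarrow x$ in $\mathcal{C}$, $Mx=Mu\cup\bigcup_{v\hookrightarrow x:\ v\cap u=\emptyset}Mv$ as subobjects of $Mx$ in $\mathcal{E}$. *)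

theory Defs
  imports "HOL-Analysis.Analysis" "HOL-Algebra.Lattice"
begin

no_notation eq_closure_of (\<open>closure'_of\<index>\<close>)  \<comment> \<open>clashes with the topological closure\<close>

section \<open>Categories\<close>

record ('o, 'm) category =
  Obj :: "'o set"
  Arr :: "'m set"
  Src :: "'m \<Rightarrow> 'o"
  Tgt :: "'m \<Rightarrow> 'o"
  Idt :: "'o \<Rightarrow> 'm"
  Cmp :: "'m \<Rightarrow> 'm \<Rightarrow> 'm"  (infixr \<open>\<odot>\<index>\<close> 75)

definition hom_set :: "('o, 'm) category \<Rightarrow> 'o \<Rightarrow> 'o \<Rightarrow> 'm set" where
  "hom_set C x y = {f \<in> Arr C. Src C f = x \<and> Tgt C f = y}"

definition is_category :: "('o, 'm) category \<Rightarrow> bool" where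
  "is_category C \<longleftrightarrow>
     (\<forall>f\<in>Arr C. Src C f \<in> Obj C \<and> Tgt C f \<in> Obj C) \<and>
     (\<forall>x\<in>Obj C. Idt C x \<in> hom_set C x x) \<and>
     (\<forall>f\<in>Arr C. \<forall>g\<in>Arr C. Tgt C f = Src C g \<longrightarrow> g \<odot>\<^bsub>C\<^esub> f \<in> hom_set C (Src C f) (Tgt C g)) \<and>
     (\<forall>f\<in>Arr C. f \<odot>\<^bsub>C\<^esub> Idt C (Src C f) = f \<and> Idt C (Tgt C f) \<odot>\<^bsub>C\<^esub> f = f) \<and>
     (\<forall>f\<in>Arr C. \<forall>g\<in>Arr C. \<forall>h\<in>Arr C. Tgt C f = Src C g \<and> Tgt C g = Src C h \<longrightarrow>
        h \<odot>\<^bsub>C\<^esub> (g \<odot>\<^bsub>C\<^esub> f) = (h \<odot>\<^bsub>C\<^esub> g) \<odot>\<^bsub>C\<^esub> f)"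

definition is_terminal :: "('o, 'm) category \<Rightarrow> 'o \<Rightarrow> bool" where
  "is_terminal C t \<longleftrightarrow> t \<in> Obj C \<and> (\<forall>x\<in>Obj C. \<exists>!f. f \<in> hom_set C x t)"

text \<open>\<open>p\<close>, \<open>q\<close> is a pullback of the cospan \<open>f\<close>, \<open>g\<close>, with \<open>f \<odot> p = g \<odot> q\<close>.\<close>

definition is_pullback :: "('o, 'm) category \<Rightarrow> 'm \<Rightarrow> 'm \<Rightarrow> 'm \<Rightarrow> 'm \<Rightarrow> bool" where
  "is_pullback C f g p q \<longleftrightarrow>
     f \<in> Arr C \<and> g \<in> Arr C \<and> Tgt C f = Tgt C g \<and> Src C p = Src C q \<and>
     p \<in> hom_set C (Src C p) (Src C f) \<and> q \<in> hom_set C (Src C p) (Src C g) \<and>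
     f \<odot>\<^bsub>C\<^esub> p = g \<odot>\<^bsub>C\<^esub> q \<and>
     (\<forall>w\<in>Obj C. \<forall>h\<in>hom_set C w (Src C f). \<forall>k\<in>hom_set C w (Src C g).
        f \<odot>\<^bsub>C\<^esub> h = g \<odot>\<^bsub>C\<^esub> k \<longrightarrow>
        (\<exists>!l. l \<in> hom_set C w (Src C p) \<and> p \<odot>\<^bsub>C\<^esub> l = h \<and> q \<odot>\<^bsub>C\<^esub> l = k))"

definition pullback_along :: "('o, 'm) category \<Rightarrow> 'm \<Rightarrow> 'm \<Rightarrow> 'm \<Rightarrow> bool" where
  "pullback_along C g f f' \<longleftrightarrow> (\<exists>q. is_pullback C f g q f')"

definition is_mono :: "('o, 'm) category \<Rightarrow> 'm \<Rightarrow> bool" where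
  "is_mono C m \<longleftrightarrow> m \<in> Arr C \<and>
     (\<forall>w\<in>Obj C. \<forall>h\<in>hom_set C w (Src C m). \<forall>k\<in>hom_set C w (Src C m).
        m \<odot>\<^bsub>C\<^esub> h = m \<odot>\<^bsub>C\<^esub> k \<longrightarrow> h = k)"

text \<open>Subobjects are represented by monomorphisms, compared by the factorization preorder;
  images and unions are therefore determined up to isomorphism of subobjects.\<close>

definition subobjects :: "('o, 'm) category \<Rightarrow> 'o \<Rightarrow> 'm set" where
  "subobjects C x = {m. is_mono C m \<and> Tgt C m = x}"

definition factors_through :: "('o, 'm) category \<Rightarrow> 'm \<Rightarrow> 'm \<Rightarrow> bool" where
  "factors_through C f m \<longleftrightarrow> (\<exists>h\<in>hom_set C (Src C f) (Src C m). m \<odot>\<^bsub>C\<^esub> h = f)"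

definition is_image :: "('o, 'm) category \<Rightarrow> 'm \<Rightarrow> 'm \<Rightarrow> bool" where
  "is_image C f m \<longleftrightarrow> f \<in> Arr C \<and> m \<in> subobjects C (Tgt C f) \<and> factors_through C f m \<and>
     (\<forall>n\<in>subobjects C (Tgt C f). factors_through C f n \<longrightarrow> factors_through C m n)"

definition is_union :: "('o, 'm) category \<Rightarrow> 'o \<Rightarrow> 'm set \<Rightarrow> 'm \<Rightarrow> bool" where
  "is_union C x S m \<longleftrightarrow> x \<in> Obj C \<and> S \<subseteq> subobjects C x \<and> m \<in> subobjects C x \<and>
     (\<forall>s\<in>S. factors_through C s m) \<and>
     (\<forall>n\<in>subobjects C x. (\<forall>s\<in>S. factors_through C s n) \<longrightarrow> factors_through C m n)"

text \<open>The intersection of \<open>u\<close> and \<open>v\<close> is the least subobject, i.e. the union of no subobjects.\<close>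

definition disjoint_subobjects :: "('o, 'm) category \<Rightarrow> 'm \<Rightarrow> 'm \<Rightarrow> bool" where
  "disjoint_subobjects C u v \<longleftrightarrow>
     (\<exists>p q. is_pullback C u v p q \<and> is_union C (Tgt C u) {} (u \<odot>\<^bsub>C\<^esub> p))"

text \<open>Finite limits are expressed through a terminal object and pullbacks.\<close>

definition coherent_category :: "('o, 'm) category \<Rightarrow> bool" where
  "coherent_category C \<longleftrightarrow> is_category C \<and>
     (\<exists>t. is_terminal C t) \<and>
     (\<forall>f\<in>Arr C. \<forall>g\<in>Arr C. Tgt C f = Tgt C g \<longrightarrow> (\<exists>p q. is_pullback C f g p q)) \<and>
     (\<forall>f\<in>Arr C. \<exists>m. is_image C f m) \<and>
     (\<forall>f m g f' m'. is_image C f m \<and> pullback_along C g f f' \<and> pullback_along C g m m' \<longrightarrow>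
        is_image C f' m') \<and>
     (\<forall>x\<in>Obj C. \<forall>S. finite S \<and> S \<subseteq> subobjects C x \<longrightarrow> (\<exists>m. is_union C x S m)) \<and>
     (\<forall>x S m g m'. finite S \<and> is_union C x S m \<and> pullback_along C g m m' \<longrightarrow>
        is_union C (Src C g) {s'. \<exists>s\<in>S. pullback_along C g s s'} m')"

section \<open>Coherent functors and natural transformations\<close>

record ('o, 'm, 'p, 'n) fnctr =
  on_obj :: "'o \<Rightarrow> 'p"
  on_arr :: "'m \<Rightarrow> 'n"

definition is_functor ::
  "('o, 'm) category \<Rightarrow> ('p, 'n) category \<Rightarrow> ('o, 'm, 'p, 'n) fnctr \<Rightarrow> bool" where
  "is_functor C D F \<longleftrightarrow> is_category C \<and> is_category D \<and>
     (\<forall>x\<in>Obj C. on_obj F x \<in> Obj D) \<and>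
     (\<forall>f\<in>Arr C. on_arr F f \<in> hom_set D (on_obj F (Src C f)) (on_obj F (Tgt C f))) \<and>
     (\<forall>x\<in>Obj C. on_arr F (Idt C x) = Idt D (on_obj F x)) \<and>
     (\<forall>f\<in>Arr C. \<forall>g\<in>Arr C. Tgt C f = Src C g \<longrightarrow>
        on_arr F (g \<odot>\<^bsub>C\<^esub> f) = on_arr F g \<odot>\<^bsub>D\<^esub> on_arr F f)"

definition comp_functor ::
  "('p, 'n, 'q, 'r) fnctr \<Rightarrow> ('o, 'm, 'p, 'n) fnctr \<Rightarrow> ('o, 'm, 'q, 'r) fnctr" where
  "comp_functor G F = \<lparr>on_obj = on_obj G \<circ> on_obj F, on_arr = on_arr G \<circ> on_arr F\<rparr>"

definition coherent_functor ::
  "('o, 'm) category \<Rightarrow> ('p, 'n) category \<Rightarrow> ('o, 'm, 'p, 'n) fnctr \<Rightarrow> bool" where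
  "coherent_functor C D F \<longleftrightarrow> coherent_category C \<and> is_functor C D F \<and>
     (\<forall>t. is_terminal C t \<longrightarrow> is_terminal D (on_obj F t)) \<and>
     (\<forall>f g p q. is_pullback C f g p q \<longrightarrow>
        is_pullback D (on_arr F f) (on_arr F g) (on_arr F p) (on_arr F q)) \<and>
     (\<forall>f m. is_image C f m \<longrightarrow> is_image D (on_arr F f) (on_arr F m)) \<and>
     (\<forall>x S m. finite S \<and> is_union C x S m \<longrightarrow>
        is_union D (on_obj F x) (on_arr F ` S) (on_arr F m))"

definition is_natural_transformation ::
  "('o, 'm) category \<Rightarrow> ('p, 'n) category \<Rightarrow> ('o, 'm, 'p, 'n) fnctr \<Rightarrow> ('o, 'm, 'p, 'n) fnctr \<Rightarrow>
     ('o \<Rightarrow> 'n) \<Rightarrow> bool" where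
  "is_natural_transformation C D M N \<eta> \<longleftrightarrow>
     (\<forall>x\<in>Obj C. \<eta> x \<in> hom_set D (on_obj M x) (on_obj N x)) \<and>
     (\<forall>f\<in>Arr C. on_arr N f \<odot>\<^bsub>D\<^esub> \<eta> (Src C f) = \<eta> (Tgt C f) \<odot>\<^bsub>D\<^esub> on_arr M f)"

definition is_elementary ::
  "('o, 'm) category \<Rightarrow> ('p, 'n) category \<Rightarrow> ('o, 'm, 'p, 'n) fnctr \<Rightarrow> ('o, 'm, 'p, 'n) fnctr \<Rightarrow>
     ('o \<Rightarrow> 'n) \<Rightarrow> bool" where
  "is_elementary C D M N \<eta> \<longleftrightarrow>
     (\<forall>u. is_mono C u \<longrightarrow>
        is_pullback D (on_arr N u) (\<eta> (Tgt C u)) (\<eta> (Src C u)) (on_arr M u))"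

definition positively_closed ::
  "('o, 'm) category \<Rightarrow> ('p, 'n) category \<Rightarrow> ('o, 'm, 'p, 'n) fnctr \<Rightarrow> bool" where
  "positively_closed C D M \<longleftrightarrow>
     (\<forall>N \<eta>. coherent_functor C D N \<and> is_natural_transformation C D M N \<eta> \<longrightarrow>
        is_elementary C D M N \<eta>)"

definition strongly_positively_closed ::
  "('o, 'm) category \<Rightarrow> ('p, 'n) category \<Rightarrow> ('o, 'm, 'p, 'n) fnctr \<Rightarrow> bool" where
  "strongly_positively_closed C D M \<longleftrightarrow>
     (\<forall>x\<in>Obj C. \<forall>u\<in>subobjects C x.
        is_union D (on_obj M x)
          (insert (on_arr M u)
            (on_arr M ` {v \<in> subobjects C x. disjoint_subobjects C v u}))
          (Idt D (on_obj M x)))"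

section \<open>Sheaves on a poset with a coverage\<close>

definition poset_category :: "'b gorder \<Rightarrow> ('b, 'b \<times> 'b) category" where
  "poset_category L =
     \<lparr>Obj = carrier L,
      Arr = {(a, b). a \<in> carrier L \<and> b \<in> carrier L \<and> a \<sqsubseteq>\<^bsub>L\<^esub> b},
      Src = fst, Tgt = snd, Idt = (\<lambda>a. (a, a)), Cmp = (\<lambda>g f. (fst f, snd g))\<rparr>"

definition poset_functor :: "('b \<Rightarrow> 'c) \<Rightarrow> ('b, 'b \<times> 'b, 'c, 'c \<times> 'c) fnctr" where
  "poset_functor h = \<lparr>on_obj = h, on_arr = map_prod h h\<rparr>"

text \<open>Sections are drawn from a type \<open>'v\<close>. \<open>Res P b c\<close> is the restriction from \<open>b\<close> to
  \<open>c \<sqsubseteq> b\<close>; its values elsewhere are irrelevant.\<close>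

record ('b, 'v) presheaf =
  Sec :: "'b \<Rightarrow> 'v set"
  Res :: "'b \<Rightarrow> 'b \<Rightarrow> 'v \<Rightarrow> 'v"

definition is_presheaf :: "'b gorder \<Rightarrow> ('b, 'v) presheaf \<Rightarrow> bool" where
  "is_presheaf B P \<longleftrightarrow>
     (\<forall>b\<in>carrier B. \<forall>c\<in>carrier B. c \<sqsubseteq>\<^bsub>B\<^esub> b \<longrightarrow> Res P b c \<in> Sec P b \<rightarrow> Sec P c) \<and>
     (\<forall>b\<in>carrier B. \<forall>s\<in>Sec P b. Res P b b s = s) \<and>
     (\<forall>b\<in>carrier B. \<forall>c\<in>carrier B. \<forall>d\<in>carrier B. d \<sqsubseteq>\<^bsub>B\<^esub> c \<and> c \<sqsubseteq>\<^bsub>B\<^esub> b \<longrightarrow>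
        (\<forall>s\<in>Sec P b. Res P c d (Res P b c s) = Res P b d s))"

definition matching_family ::
  "'b gorder \<Rightarrow> ('b, 'v) presheaf \<Rightarrow> 'b set \<Rightarrow> ('b \<Rightarrow> 'v) \<Rightarrow> bool" where
  "matching_family B P S s \<longleftrightarrow>
     (\<forall>c\<in>S. s c \<in> Sec P c) \<and>
     (\<forall>c\<in>S. \<forall>c'\<in>S. \<forall>d\<in>carrier B. d \<sqsubseteq>\<^bsub>B\<^esub> c \<and> d \<sqsubseteq>\<^bsub>B\<^esub> c' \<longrightarrow>
        Res P c d (s c) = Res P c' d (s c'))"

text \<open>\<open>K b\<close> is the collection of covering families of \<open>b\<close>, given as sets of elements below \<open>b\<close>.\<close>

definition is_sheaf ::
  "'b gorder \<Rightarrow> ('b \<Rightarrow> 'b set set) \<Rightarrow> ('b, 'v) presheaf \<Rightarrow> bool" where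
  "is_sheaf B K P \<longleftrightarrow> is_presheaf B P \<and>
     (\<forall>b\<in>carrier B. \<forall>S\<in>K b. \<forall>s. matching_family B P S s \<longrightarrow>
        (\<exists>!t. t \<in> Sec P b \<and> (\<forall>c\<in>S. Res P b c t = s c)))"

text \<open>Components are extensional functions, so that equality of sheaf morphisms is equality in HOL.\<close>

definition presheaf_morphisms ::
  "'b gorder \<Rightarrow> ('b, 'v) presheaf \<Rightarrow> ('b, 'v) presheaf \<Rightarrow> ('b \<Rightarrow> 'v \<Rightarrow> 'v) set" where
  "presheaf_morphisms B P Q =
     {\<phi> \<in> (\<Pi>\<^sub>E b\<in>carrier B. Sec P b \<rightarrow>\<^sub>E Sec Q b).
        \<forall>b\<in>carrier B. \<forall>c\<in>carrier B. c \<sqsubseteq>\<^bsub>B\<^esub> b \<longrightarrow>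
          (\<forall>s\<in>Sec P b. \<phi> c (Res P b c s) = Res Q b c (\<phi> b s))}"

type_synonym ('b, 'v) sheaf_arrow =
  "('b, 'v) presheaf \<times> ('b, 'v) presheaf \<times> ('b \<Rightarrow> 'v \<Rightarrow> 'v)"

text \<open>HOL has no type of all sets, so this is the category of those sheaves whose sections lie in
  \<open>'v\<close>. For every \<open>'v\<close> it is a full subcategory of the sheaf topos which contains the representables
  and is closed under subobjects; hence monomorphisms, pullback squares, images and unions of
  subobjects in it are the same as in the topos. As \<open>'v\<close> is arbitrary, and a functor out of a
  poset has only a set of values, no functor into the topos is lost by this restriction.\<close>

definition sheaf_category ::
  "'b gorder \<Rightarrow> ('b \<Rightarrow> 'b set set) \<Rightarrow> (('b, 'v) presheaf, ('b, 'v) sheaf_arrow) category" where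
  "sheaf_category B K =
     \<lparr>Obj = {P. is_sheaf B K P},
      Arr = {(P, Q, \<phi>). is_sheaf B K P \<and> is_sheaf B K Q \<and> \<phi> \<in> presheaf_morphisms B P Q},
      Src = fst, Tgt = fst \<circ> snd,
      Idt = (\<lambda>P. (P, P, \<lambda>b\<in>carrier B. \<lambda>s\<in>Sec P b. s)),
      Cmp = (\<lambda>(Q', R, \<psi>) (P, Q, \<phi>). (P, R, \<lambda>b\<in>carrier B. compose (Sec P b) (\<psi> b) (\<phi> b)))\<rparr>"

text \<open>The topology \<open>\<tau>\<^bsub>\<omega>-coh\<^esub>\<close>: finite families with join \<open>b\<close>. The empty family covers exactly
  the bottom element.\<close>

definition coherent_coverage :: "'b gorder \<Rightarrow> 'b \<Rightarrow> 'b set set" where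
  "coherent_coverage B b = {S. finite S \<and> S \<subseteq> carrier B \<and> least B b (Upper B S)}"

text \<open>The hom-set of arrows from \<open>c\<close> to \<open>b\<close> is empty or has one element; \<open>undefined\<close> serves as
  its name in \<open>'v\<close>.\<close>

definition representable :: "'b gorder \<Rightarrow> 'b \<Rightarrow> ('b, 'v) presheaf" where
  "representable B b =
     \<lparr>Sec = (\<lambda>c. if c \<sqsubseteq>\<^bsub>B\<^esub> b then {undefined} else {}), Res = (\<lambda>_ _ s. s)\<rparr>"

definition yoneda ::
  "'b gorder \<Rightarrow> ('b, 'b \<times> 'b, ('b, 'v) presheaf, ('b, 'v) sheaf_arrow) fnctr" where
  "yoneda B =
     \<lparr>on_obj = representable B,
      on_arr = (\<lambda>(a, b). (representable B a, representable B b,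
        \<lambda>c\<in>carrier B. \<lambda>s\<in>Sec (representable B a :: ('b, 'v) presheaf) c. s))\<rparr>"

section \<open>Closed and clopen sets of a space\<close>

definition Stone_space :: "'a topology \<Rightarrow> bool" where
  "Stone_space X \<longleftrightarrow> compact_space X \<and> Hausdorff_space X \<and>
     (\<forall>S. connectedin X S \<longrightarrow> (\<exists>a. S \<subseteq> {a}))"

definition extremally_disconnected :: "'a topology \<Rightarrow> bool" where
  "extremally_disconnected X \<longleftrightarrow> (\<forall>U. openin X U \<longrightarrow> openin X (X closure_of U))"

definition Closed :: "'a topology \<Rightarrow> 'a set gorder" where
  "Closed X = \<lparr>carrier = {C. closedin X C}, eq = (=), le = (\<subseteq>)\<rparr>"

definition Clopen :: "'a topology \<Rightarrow> 'a set gorder" where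
  "Clopen X = \<lparr>carrier = {C. closedin X C \<and> openin X C}, eq = (=), le = (\<subseteq>)\<rparr>"

definition bounded_lattice_hom :: "'b gorder \<Rightarrow> 'c gorder \<Rightarrow> ('b \<Rightarrow> 'c) \<Rightarrow> bool" where
  "bounded_lattice_hom L M h \<longleftrightarrow> bounded_lattice L \<and> bounded_lattice M \<and>
     h \<in> carrier L \<rightarrow> carrier M \<and> join_pres L M h \<and> meet_pres L M h \<and>
     h \<top>\<^bsub>L\<^esub> = \<top>\<^bsub>M\<^esub> \<and> h \<bottom>\<^bsub>L\<^esub> = \<bottom>\<^bsub>M\<^esub>"

abbreviation Sh_Clopen ::
  "'a topology \<Rightarrow> (('a set, 'v) presheaf, ('a set, 'v) sheaf_arrow) category" where
  "Sh_Clopen X \<equiv> sheaf_category (Clopen X) (coherent_coverage (Clopen X))"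

definition int_functor ::
  "'a topology \<Rightarrow>
     ('a set, 'a set \<times> 'a set, ('a set, 'v) presheaf, ('a set, 'v) sheaf_arrow) fnctr" where
  "int_functor X = comp_functor (yoneda (Clopen X)) (poset_functor (\<lambda>C. X interior_of C))"

end

(*
  A homomorphism h from a lattice of sets G to a lattice of sets F induces a coherent functor from G
  to the sheaves on F for the topology of finite unions. Its values, and those of any other coherent
  functor on G, are subterminal sheaves, so arrows between them are unique and pullbacks and
  factorizations only depend on which elements of F carry a section.

  Positive closedness: let N receive a natural transformation from int. If N C has a section over a
  clopen b that is not below int C, then b - C is open and nonempty, and by regularity it contains a
  closed E with nonempty interior. Over the intersection of int E and b both N C and N E have a
  section, although N C and N E intersect in N {} = 0.

  Failure of the strong form: for a non-isolated point x, the clopen sets avoiding x form a proper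
  subsheaf of 1 that contains int {x} = {} and int V for all closed V avoiding x.
*)

theory Submission
  imports Defs
begin

section \<open>Lattices of sets\<close>

text \<open>Both \<open>Closed X\<close> and \<open>Clopen X\<close> have this form, so source and
  site are treated by one theory.\<close>

definition set_poset :: "'a set set \<Rightarrow> 'a set gorder" where
  "set_poset F = \<lparr>carrier = F, eq = (=), le = (\<subseteq>)\<rparr>"

lemma set_poset_simps [simp]:
  "carrier (set_poset F) = F" "le (set_poset F) = (\<subseteq>)" "eq (set_poset F) = (=)"
  by (simp_all add: set_poset_def)

locale lattice_of_sets =
  fixes F :: "'a set set" and T :: "'a set"
  assumes subset_top: "A \<in> F \<Longrightarrow> A \<subseteq> T"
    and top_in [simp]: "T \<in> F"
    and empty_in [simp]: "{} \<in> F"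
    and Un_in [simp]: "\<lbrakk>A \<in> F; B \<in> F\<rbrakk> \<Longrightarrow> A \<union> B \<in> F"
    and Int_in [simp]: "\<lbrakk>A \<in> F; B \<in> F\<rbrakk> \<Longrightarrow> A \<inter> B \<in> F"
begin

lemma Union_in: "\<lbrakk>finite S; S \<subseteq> F\<rbrakk> \<Longrightarrow> \<Union>S \<in> F"
  by (induction S rule: finite_induct) auto

text \<open>A finite union is again an element of \<open>F\<close>, so it is itself the least upper
  bound. This computes joins and also identifies the covers of the topology.\<close>

lemma least_iff:
  "least (set_poset F) m (Upper (set_poset F) S) \<longleftrightarrow> m = \<Union>S"
  if "finite S" "S \<subseteq> F"
proof
  assume m: "least (set_poset F) m (Upper (set_poset F) S)"
  have "\<Union>S \<in> Upper (set_poset F) S"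
    using Union_in[OF that] by (auto simp: Upper_def)
  then have "m \<subseteq> \<Union>S"
    using m by (auto simp: least_def)
  moreover have "\<Union>S \<subseteq> m"
    using m that by (auto simp: least_def Upper_def)
  ultimately show "m = \<Union>S" by auto
next
  assume "m = \<Union>S"
  then show "least (set_poset F) m (Upper (set_poset F) S)"
    using Union_in[OF that] that by (auto simp: least_def Upper_def)
qed

lemma greatest_iff:
  "greatest (set_poset F) m (Lower (set_poset F) {A, B}) \<longleftrightarrow> m = A \<inter> B"
  if "A \<in> F" "B \<in> F"
proof
  assume m: "greatest (set_poset F) m (Lower (set_poset F) {A, B})"
  have "A \<inter> B \<in> Lower (set_poset F) {A, B}"
    using that by (auto simp: Lower_def)
  then have "A \<inter> B \<subseteq> m"
    using m by (auto simp: greatest_def)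
  moreover have "m \<subseteq> A \<inter> B"
    using m that by (auto simp: greatest_def Lower_def)
  ultimately show "m = A \<inter> B" by auto
next
  assume "m = A \<inter> B"
  then show "greatest (set_poset F) m (Lower (set_poset F) {A, B})"
    using that by (auto simp: greatest_def Lower_def)
qed

lemma lattice_set_poset: "Lattice.lattice (set_poset F)"
proof unfold_locales
  fix A B
  assume AB: "A \<in> carrier (set_poset F)" "B \<in> carrier (set_poset F)"
  show "\<exists>s. least (set_poset F) s (Upper (set_poset F) {A, B})"
    using AB least_iff[of "{A, B}"] by auto
  show "\<exists>s. greatest (set_poset F) s (Lower (set_poset F) {A, B})"
    using AB greatest_iff by auto
qed auto

lemma bounded_lattice_set_poset: "bounded_lattice (set_poset F)"
proof -
  interpret L: Lattice.lattice "set_poset F"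
    by (rule lattice_set_poset)
  show ?thesis
  proof unfold_locales
    have "least (set_poset F) {} F"
      by (auto simp: least_def)
    then show "\<exists>x. least (set_poset F) x (carrier (set_poset F))"
      by auto
    have "greatest (set_poset F) T F"
      using subset_top by (auto simp: greatest_def)
    then show "\<exists>x. greatest (set_poset F) x (carrier (set_poset F))"
      by auto
  qed
qed

lemma join_eq: "A \<in> F \<Longrightarrow> B \<in> F \<Longrightarrow> A \<squnion>\<^bsub>set_poset F\<^esub> B = A \<union> B"
  unfolding join_def sup_def by (simp add: least_iff)

lemma meet_eq: "A \<in> F \<Longrightarrow> B \<in> F \<Longrightarrow> A \<sqinter>\<^bsub>set_poset F\<^esub> B = A \<inter> B"
  unfolding meet_def inf_def by (simp add: greatest_iff)

lemma bottom_eq: "\<bottom>\<^bsub>set_poset F\<^esub> = {}"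
  unfolding bottom_def by (rule some_equality) (auto simp: least_def)

lemma top_eq: "\<top>\<^bsub>set_poset F\<^esub> = T"
  unfolding top_def by (rule some_equality) (use subset_top in \<open>auto simp: greatest_def\<close>)

end

section \<open>A lattice of sets as a coherent category\<close>

lemma is_pullback_lift:
  "\<lbrakk>is_pullback C f g p q; w \<in> Obj C; h \<in> hom_set C w (Src C f); k \<in> hom_set C w (Src C g);
    f \<odot>\<^bsub>C\<^esub> h = g \<odot>\<^bsub>C\<^esub> k\<rbrakk>
   \<Longrightarrow> \<exists>l\<in>hom_set C w (Src C p). p \<odot>\<^bsub>C\<^esub> l = h \<and> q \<odot>\<^bsub>C\<^esub> l = k"
  unfolding is_pullback_def by blast

context lattice_of_sets
begin

abbreviation Pos :: "('a set, 'a set \<times> 'a set) category" where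
  "Pos \<equiv> poset_category (set_poset F)"

lemma Pos_simps [simp]:
  "Obj Pos = F" "Arr Pos = {(a, b). a \<in> F \<and> b \<in> F \<and> a \<subseteq> b}" "Src Pos = fst" "Tgt Pos = snd"
  "Idt Pos a = (a, a)" "g \<odot>\<^bsub>Pos\<^esub> f = (fst f, snd g)"
  by (simp_all add: poset_category_def)

lemma hom_set_Pos [simp]:
  "hom_set Pos a b = (if a \<in> F \<and> b \<in> F \<and> a \<subseteq> b then {(a, b)} else {})"
  by (auto simp: hom_set_def)

lemma is_category_Pos: "is_category Pos"
  by (auto simp: is_category_def)

lemma is_terminal_Pos_iff: "is_terminal Pos t \<longleftrightarrow> t = T"
proof
  assume t: "is_terminal Pos t"
  then have "T \<in> Obj Pos \<Longrightarrow> \<exists>f. f \<in> hom_set Pos T t" and "t \<in> Obj Pos"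
    unfolding is_terminal_def by blast+
  then show "t = T"
    using subset_top by (auto split: if_splits)
next
  assume "t = T"
  then show "is_terminal Pos t"
    using subset_top by (simp add: is_terminal_def)
qed

text \<open>Parallel arrows agree, so a pullback is a meet of subsets of \<open>c\<close>; testing
  the pullback against the cone with apex \<open>a \<inter> b\<close> gives the inclusion that
  determines the apex.\<close>

lemma is_pullback_Pos_iff:
  "is_pullback Pos f g p q \<longleftrightarrow>
     (\<exists>a\<in>F. \<exists>b\<in>F. \<exists>c\<in>F. a \<subseteq> c \<and> b \<subseteq> c \<and>
        f = (a, c) \<and> g = (b, c) \<and> p = (a \<inter> b, a) \<and> q = (a \<inter> b, b))"
  (is "?l \<longleftrightarrow> ?r")
proof
  assume l: ?l
  then have "f \<in> Arr Pos \<and> g \<in> Arr Pos \<and> Tgt Pos f = Tgt Pos g \<and> Src Pos p = Src Pos q \<and>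
      p \<in> hom_set Pos (Src Pos p) (Src Pos f) \<and> q \<in> hom_set Pos (Src Pos p) (Src Pos g)"
    unfolding is_pullback_def by blast
  then obtain a b c d where fg: "f = (a, c)" "g = (b, c)" "p = (d, a)" "q = (d, b)"
    and in_F: "a \<in> F" "b \<in> F" "c \<in> F" "d \<in> F" "a \<subseteq> c" "b \<subseteq> c" "d \<subseteq> a" "d \<subseteq> b"
    by (cases f; cases g; cases p; cases q) (auto split: if_splits)
  have "(a \<inter> b, a) \<in> hom_set Pos (a \<inter> b) (Src Pos f)" "(a \<inter> b, b) \<in> hom_set Pos (a \<inter> b) (Src Pos g)"
    "f \<odot>\<^bsub>Pos\<^esub> (a \<inter> b, a) = g \<odot>\<^bsub>Pos\<^esub> (a \<inter> b, b)" "a \<inter> b \<in> Obj Pos"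
    using in_F fg by auto
  then have "\<exists>l. l \<in> hom_set Pos (a \<inter> b) (Src Pos p)"
    using is_pullback_lift[OF l] by blast
  then have "d = a \<inter> b"
    using in_F fg by (auto split: if_splits)
  then show ?r using fg in_F by blast
next
  assume ?r
  then show ?l by (auto simp: is_pullback_def split: if_splits)
qed

lemma is_mono_Pos_iff: "is_mono Pos m \<longleftrightarrow> m \<in> Arr Pos"
  by (auto simp: is_mono_def split: if_splits)

lemma subobjects_Pos_iff:
  "s \<in> subobjects Pos x \<longleftrightarrow> x \<in> F \<and> fst s \<in> F \<and> fst s \<subseteq> x \<and> s = (fst s, x)"
  by (cases s) (auto simp: subobjects_def is_mono_Pos_iff)

lemma factors_through_Pos_iff:
  "factors_through Pos (a, x) (b, x) \<longleftrightarrow> a \<in> F \<and> b \<in> F \<and> a \<subseteq> b"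
  by (auto simp: factors_through_def)

text \<open>Every arrow is a monomorphism and hence its own image; antisymmetry of inclusion makes
  the image unique on the nose.\<close>

lemma is_image_Pos_iff: "is_image Pos f m \<longleftrightarrow> f \<in> Arr Pos \<and> m = f"
proof
  assume m: "is_image Pos f m"
  then have f: "f \<in> Arr Pos" and "m \<in> subobjects Pos (snd f)" "factors_through Pos f m"
    and least: "\<And>n. \<lbrakk>n \<in> subobjects Pos (snd f); factors_through Pos f n\<rbrakk> \<Longrightarrow> factors_through Pos m n"
    by (auto simp: is_image_def)
  moreover obtain a b c where "f = (a, b)" "m = (c, b)"
    using calculation by (metis prod.collapse subobjects_Pos_iff snd_conv)
  moreover have "factors_through Pos m f"
    using f calculation(5) by (intro least) (auto simp: subobjects_Pos_iff factors_through_Pos_iff)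
  ultimately show "f \<in> Arr Pos \<and> m = f"
    by (auto simp: factors_through_Pos_iff)
next
  assume "f \<in> Arr Pos \<and> m = f"
  then show "is_image Pos f m"
    by (cases f) (auto simp: is_image_def subobjects_Pos_iff factors_through_Pos_iff)
qed

text \<open>Finiteness of \<open>S\<close> keeps the set-theoretic union of the sources in
  \<open>F\<close>, so it competes with \<open>m\<close> as an upper bound; antisymmetry then gives
  equality.\<close>

lemma is_union_Pos_iff:
  assumes "finite S"
  shows "is_union Pos x S m \<longleftrightarrow> x \<in> F \<and> S \<subseteq> subobjects Pos x \<and> m = (\<Union>(fst ` S), x)"
proof (cases "x \<in> F \<and> S \<subseteq> subobjects Pos x")
  case True
  have S: "s = (fst s, x) \<and> fst s \<in> F \<and> fst s \<subseteq> x" if "s \<in> S" for s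
    using True that by (meson subobjects_Pos_iff subsetD)
  have U: "\<Union>(fst ` S) \<in> F"
    using assms S by (intro Union_in) auto
  have ft: "factors_through Pos s (b, x) \<longleftrightarrow> b \<in> F \<and> fst s \<subseteq> b" if "s \<in> S" for s b
    using S[OF that] factors_through_Pos_iff by metis
  show ?thesis
  proof
    assume m: "is_union Pos x S m"
    then have "m \<in> subobjects Pos x" and m_ub: "\<And>s. s \<in> S \<Longrightarrow> factors_through Pos s m"
      by (auto simp: is_union_def)
    then obtain a where a: "m = (a, x)" "a \<in> F" "a \<subseteq> x"
      unfolding subobjects_Pos_iff by blast
    with m_ub have "\<forall>s\<in>S. fst s \<subseteq> a"
      using ft by blast
    have "factors_through Pos m (\<Union>(fst ` S), x)"
    proof -
      have "(\<Union>(fst ` S), x) \<in> subobjects Pos x"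
        using U True S by (auto simp: subobjects_Pos_iff)
      moreover have "\<forall>s\<in>S. factors_through Pos s (\<Union>(fst ` S), x)"
        using ft U by auto
      ultimately show ?thesis using m by (auto simp: is_union_def)
    qed
    then have "a \<subseteq> \<Union>(fst ` S)"
      using a factors_through_Pos_iff by blast
    with \<open>\<forall>s\<in>S. fst s \<subseteq> a\<close> have "a = \<Union>(fst ` S)" by blast
    then show "x \<in> F \<and> S \<subseteq> subobjects Pos x \<and> m = (\<Union>(fst ` S), x)"
      using True a by auto
  next
    assume "x \<in> F \<and> S \<subseteq> subobjects Pos x \<and> m = (\<Union>(fst ` S), x)"
    then have m: "m = (\<Union>(fst ` S), x)" by auto
    have "m \<in> subobjects Pos x"
      using U True S unfolding m by (auto simp: subobjects_Pos_iff)
    moreover have "\<forall>s\<in>S. factors_through Pos s m"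
      using ft U m by auto
    moreover have "factors_through Pos m n"
      if n: "n \<in> subobjects Pos x" "\<forall>s\<in>S. factors_through Pos s n" for n
    proof -
      obtain b where b: "n = (b, x)" "b \<in> F"
        using n unfolding subobjects_Pos_iff by blast
      then have "\<forall>s\<in>S. fst s \<subseteq> b"
        using n ft by auto
      then show ?thesis
        using b U unfolding m b(1) factors_through_Pos_iff by auto
    qed
    ultimately show "is_union Pos x S m"
      using True unfolding is_union_def by auto
  qed
qed (auto simp: is_union_def)

lemma pullback_along_Pos_iff:
  "pullback_along Pos (b, x) (a, x) s \<longleftrightarrow>
     a \<in> F \<and> b \<in> F \<and> x \<in> F \<and> a \<subseteq> x \<and> b \<subseteq> x \<and> s = (a \<inter> b, b)"
  by (auto simp: pullback_along_def is_pullback_Pos_iff)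

text \<open>Images are stable because they are trivial. Pulling back along \<open>(b, x)\<close>
  intersects with \<open>b\<close>, so stability of unions is distributivity of intersection over
  union.\<close>

lemma coherent_category_Pos: "coherent_category Pos"
  unfolding coherent_category_def
proof (intro conjI allI ballI impI)
  show "is_category Pos" by (rule is_category_Pos)
  show "\<exists>t. is_terminal Pos t" by (simp add: is_terminal_Pos_iff)
next
  fix f g assume "f \<in> Arr Pos" "g \<in> Arr Pos" "Tgt Pos f = Tgt Pos g"
  then show "\<exists>p q. is_pullback Pos f g p q"
    by (auto simp: is_pullback_Pos_iff)
next
  fix f assume "f \<in> Arr Pos"
  then show "\<exists>m. is_image Pos f m"
    by (simp add: is_image_Pos_iff)
next
  fix f m g f' m'
  assume a: "is_image Pos f m \<and> pullback_along Pos g f f' \<and> pullback_along Pos g m m'"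
  then have "m = f" by (simp add: is_image_Pos_iff)
  with a obtain q q' where "is_pullback Pos f g q f'" "is_pullback Pos f g q' m'"
    by (auto simp: pullback_along_def)
  then show "is_image Pos f' m'"
    by (auto simp: is_pullback_Pos_iff is_image_Pos_iff)
next
  fix x S assume "x \<in> Obj Pos" "finite S \<and> S \<subseteq> subobjects Pos x"
  then show "\<exists>m. is_union Pos x S m"
    by (simp add: is_union_Pos_iff)
next
  fix x S m g m'
  assume a: "finite S \<and> is_union Pos x S m \<and> pullback_along Pos g m m'"
  then have m: "m = (\<Union>(fst ` S), x)" and S: "S \<subseteq> subobjects Pos x" and x: "x \<in> F"
    by (auto simp: is_union_Pos_iff)
  obtain b where g: "g = (b, x)"
    using a m by (cases g) (auto simp: pullback_along_def is_pullback_Pos_iff)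
  have b: "b \<in> F" "b \<subseteq> x" and m': "m' = (\<Union>(fst ` S) \<inter> b, b)"
    using a unfolding m g pullback_along_Pos_iff by auto
  have pb: "pullback_along Pos g s s' \<longleftrightarrow> s' = (fst s \<inter> b, b)" if "s \<in> S" for s s'
  proof -
    have "s = (fst s, x)" "fst s \<in> F" "fst s \<subseteq> x"
      using that S subobjects_Pos_iff by blast+
    then show ?thesis
      using b x pullback_along_Pos_iff unfolding g by metis
  qed
  have eq: "{s'. \<exists>s\<in>S. pullback_along Pos g s s'} = (\<lambda>s. (fst s \<inter> b, b)) ` S"
    using pb by auto
  show "is_union Pos (Src Pos g) {s'. \<exists>s\<in>S. pullback_along Pos g s s'} m'"
  proof -
    have "(fst s \<inter> b, b) \<in> subobjects Pos b" if "s \<in> S" for s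
    proof -
      have "fst s \<in> F"
        using that S subobjects_Pos_iff by blast
      then show ?thesis using b by (simp add: subobjects_Pos_iff)
    qed
    then show ?thesis
      unfolding eq using a b g m' by (auto simp: is_union_Pos_iff)
  qed
qed

end

section \<open>The category of sheaves\<close>

lemma sheaf_category_simps [simp]:
  "Obj (sheaf_category B K) = {P. is_sheaf B K P}"
  "Src (sheaf_category B K) = fst" "Tgt (sheaf_category B K) = fst \<circ> snd"
  "Idt (sheaf_category B K) P = (P, P, \<lambda>b\<in>carrier B. \<lambda>s\<in>Sec P b. s)"
  "(Q', R, \<psi>) \<odot>\<^bsub>sheaf_category B K\<^esub> (P, Q, \<phi>) =
     (P, R, \<lambda>b\<in>carrier B. compose (Sec P b) (\<psi> b) (\<phi> b))"
  by (simp_all add: sheaf_category_def)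

lemma Arr_sheaf_category_iff [simp]:
  "(P, Q, \<phi>) \<in> Arr (sheaf_category B K) \<longleftrightarrow>
     is_sheaf B K P \<and> is_sheaf B K Q \<and> \<phi> \<in> presheaf_morphisms B P Q"
  by (simp add: sheaf_category_def)

lemma hom_set_sheaf_category_iff:
  "f \<in> hom_set (sheaf_category B K) P Q \<longleftrightarrow>
     is_sheaf B K P \<and> is_sheaf B K Q \<and> (\<exists>\<phi>\<in>presheaf_morphisms B P Q. f = (P, Q, \<phi>))"
  by (cases f) (auto simp: hom_set_def)

lemma presheaf_morphisms_mem:
  assumes "\<phi> \<in> presheaf_morphisms B P Q" "b \<in> carrier B" "s \<in> Sec P b"
  shows "\<phi> b s \<in> Sec Q b"
proof -
  have "\<phi> b \<in> Sec P b \<rightarrow>\<^sub>E Sec Q b"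
    using assms by (auto simp: presheaf_morphisms_def)
  then show ?thesis
    using assms(3) by (rule PiE_mem)
qed

lemma presheaf_morphisms_compose:
  assumes "\<phi> \<in> presheaf_morphisms B P Q" "\<psi> \<in> presheaf_morphisms B Q R" "is_presheaf B P"
  shows "(\<lambda>b\<in>carrier B. compose (Sec P b) (\<psi> b) (\<phi> b)) \<in> presheaf_morphisms B P R"
proof -
  have \<phi>: "\<And>b s. b \<in> carrier B \<Longrightarrow> s \<in> Sec P b \<Longrightarrow> \<phi> b s \<in> Sec Q b"
    and \<psi>: "\<And>b s. b \<in> carrier B \<Longrightarrow> s \<in> Sec Q b \<Longrightarrow> \<psi> b s \<in> Sec R b"
    using assms(1,2)[THEN presheaf_morphisms_mem] by auto
  have Res: "Res P b c s \<in> Sec P c"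
    if "b \<in> carrier B" "c \<in> carrier B" "c \<sqsubseteq>\<^bsub>B\<^esub> b" "s \<in> Sec P b" for b c s
    using that assms(3) by (auto simp: is_presheaf_def)
  have \<phi>_nat: "\<phi> c (Res P b c s) = Res Q b c (\<phi> b s)"
    if "b \<in> carrier B" "c \<in> carrier B" "c \<sqsubseteq>\<^bsub>B\<^esub> b" "s \<in> Sec P b" for b c s
    using that assms(1) by (auto simp: presheaf_morphisms_def)
  have \<psi>_nat: "\<psi> c (Res Q b c s) = Res R b c (\<psi> b s)"
    if "b \<in> carrier B" "c \<in> carrier B" "c \<sqsubseteq>\<^bsub>B\<^esub> b" "s \<in> Sec Q b" for b c s
    using that assms(2) by (auto simp: presheaf_morphisms_def)
  show ?thesis
    unfolding presheaf_morphisms_def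
    using \<phi> \<psi> Res \<phi>_nat \<psi>_nat by (auto simp: compose_def)
qed

lemma is_category_sheaf_category: "is_category (sheaf_category B K)" (is "is_category ?C")
  unfolding is_category_def
proof (intro conjI ballI impI)
  fix f assume f: "f \<in> Arr ?C"
  then obtain P Q \<phi> where f_eq: "f = (P, Q, \<phi>)" and PQ: "is_sheaf B K P" "is_sheaf B K Q"
    and \<phi>: "\<phi> \<in> presheaf_morphisms B P Q"
    by (cases f) auto
  show "Src ?C f \<in> Obj ?C" "Tgt ?C f \<in> Obj ?C"
    using f_eq PQ by auto
  have PiE: "\<phi> \<in> (\<Pi>\<^sub>E b\<in>carrier B. Sec P b \<rightarrow>\<^sub>E Sec Q b)"
    using \<phi> by (simp add: presheaf_morphisms_def)
  \<comment> \<open>The identity laws are equalities of HOL functions, so the default values outside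
    the carrier and outside the section sets have to match too.\<close>
  have ext: "\<phi> b = undefined" if "b \<notin> carrier B" for b
    using PiE_arb[OF PiE that] .
  have PiE': "\<phi> b \<in> Sec P b \<rightarrow>\<^sub>E Sec Q b" if "b \<in> carrier B" for b
    using PiE_mem[OF PiE that] .
  have ext': "\<phi> b s = undefined" if "b \<in> carrier B" "s \<notin> Sec P b" for b s
    using PiE_arb[OF PiE'[OF that(1)] that(2)] .
  have mem: "\<phi> b s \<in> Sec Q b" if "b \<in> carrier B" "s \<in> Sec P b" for b s
    using PiE_mem[OF PiE'[OF that(1)] that(2)] .
  show "f \<odot>\<^bsub>?C\<^esub> Idt ?C (Src ?C f) = f"
    unfolding f_eq by (auto simp: compose_def fun_eq_iff restrict_def ext ext')
  show "Idt ?C (Tgt ?C f) \<odot>\<^bsub>?C\<^esub> f = f"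
    unfolding f_eq by (auto simp: compose_def fun_eq_iff restrict_def ext ext' mem)
next
  fix P assume "P \<in> Obj ?C"
  then show "Idt ?C P \<in> hom_set ?C P P"
    by (auto simp: hom_set_sheaf_category_iff presheaf_morphisms_def is_sheaf_def is_presheaf_def)
next
  fix f g assume "f \<in> Arr ?C" "g \<in> Arr ?C" "Tgt ?C f = Src ?C g"
  then show "g \<odot>\<^bsub>?C\<^esub> f \<in> hom_set ?C (Src ?C f) (Tgt ?C g)"
    by (cases f; cases g)
      (auto simp: hom_set_sheaf_category_iff is_sheaf_def intro!: presheaf_morphisms_compose)
next
  fix f g h
  assume a: "f \<in> Arr ?C" "g \<in> Arr ?C" "h \<in> Arr ?C" "Tgt ?C f = Src ?C g \<and> Tgt ?C g = Src ?C h"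
  obtain P Q R R' \<phi> \<psi> \<theta> where eq: "f = (P, Q, \<phi>)" "g = (Q, R, \<psi>)" "h = (R, R', \<theta>)"
    using a by (cases f; cases g; cases h) auto
  have "\<And>b s. b \<in> carrier B \<Longrightarrow> s \<in> Sec P b \<Longrightarrow> \<phi> b s \<in> Sec Q b"
    using a eq presheaf_morphisms_mem by auto
  then show "h \<odot>\<^bsub>?C\<^esub> (g \<odot>\<^bsub>?C\<^esub> f) = (h \<odot>\<^bsub>?C\<^esub> g) \<odot>\<^bsub>?C\<^esub> f"
    unfolding eq by (auto simp: compose_def fun_eq_iff restrict_def)
qed

lemma comp_in_hom_set:
  "\<lbrakk>is_category C; f \<in> hom_set C x y; g \<in> hom_set C y z\<rbrakk> \<Longrightarrow> g \<odot>\<^bsub>C\<^esub> f \<in> hom_set C x z"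
  by (auto simp: is_category_def hom_set_def)

text \<open>Both legs of the kernel pair are the same arrow \<open>p\<close>, so the lift of a pair
  equalized by \<open>m\<close> recovers both members as one composite with \<open>p\<close>. This
  carries monomorphisms along functors that preserve pullbacks.\<close>

lemma is_mono_if_kernel_pair_trivial:
  assumes "is_pullback C m m p p" "p = Idt C (Src C m)" "is_category C"
  shows "is_mono C m"
  unfolding is_mono_def
proof (intro conjI ballI impI)
  show "m \<in> Arr C" using assms by (auto simp: is_pullback_def)
  fix w h k
  assume w: "w \<in> Obj C" and h: "h \<in> hom_set C w (Src C m)" and k: "k \<in> hom_set C w (Src C m)"
    and eq: "m \<odot>\<^bsub>C\<^esub> h = m \<odot>\<^bsub>C\<^esub> k"
  then obtain l where "p \<odot>\<^bsub>C\<^esub> l = h" "p \<odot>\<^bsub>C\<^esub> l = k"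
    using is_pullback_lift[OF assms(1) w h k eq] by auto
  then show "h = k" by simp
qed

lemma Res_in_Sec:
  "\<lbrakk>is_presheaf B P; b \<in> carrier B; c \<in> carrier B; c \<sqsubseteq>\<^bsub>B\<^esub> b; s \<in> Sec P b\<rbrakk> \<Longrightarrow> Res P b c s \<in> Sec P c"
  by (auto simp: is_presheaf_def)

section \<open>Subterminal sheaves\<close>

text \<open>A sectionwise form of embedding into the terminal sheaf. Such a sheaf is governed by its
  support, the elements over which it has a section.\<close>

definition subterminal :: "'b gorder \<Rightarrow> ('b, 'v) presheaf \<Rightarrow> bool" where
  "subterminal B P \<longleftrightarrow> (\<forall>b\<in>carrier B. \<forall>s\<in>Sec P b. \<forall>t\<in>Sec P b. s = t)"

text \<open>Each component has only one possible value on a section, and extensionality of the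
  components turns this into equality of arrows.\<close>

lemma subterminal_hom_unique:
  assumes "subterminal B Q"
    and f: "f \<in> hom_set (sheaf_category B K) P Q" and g: "g \<in> hom_set (sheaf_category B K) P Q"
  shows "f = g"
proof -
  obtain \<phi> \<psi> where fg: "f = (P, Q, \<phi>)" "g = (P, Q, \<psi>)"
    and \<phi>: "\<phi> \<in> presheaf_morphisms B P Q" and \<psi>: "\<psi> \<in> presheaf_morphisms B P Q"
    using f g by (auto simp: hom_set_sheaf_category_iff)
  have "\<phi> = \<psi>"
  proof (rule PiE_ext)
    show "\<phi> \<in> (\<Pi>\<^sub>E b\<in>carrier B. Sec P b \<rightarrow>\<^sub>E Sec Q b)" "\<psi> \<in> (\<Pi>\<^sub>E b\<in>carrier B. Sec P b \<rightarrow>\<^sub>E Sec Q b)"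
      using \<phi> \<psi> by (auto simp: presheaf_morphisms_def)
    fix b assume b: "b \<in> carrier B"
    have "\<phi> b \<in> Sec P b \<rightarrow>\<^sub>E Sec Q b" "\<psi> b \<in> Sec P b \<rightarrow>\<^sub>E Sec Q b"
      using \<phi> \<psi> b by (auto simp: presheaf_morphisms_def)
    moreover from this have "\<phi> b s = \<psi> b s" if "s \<in> Sec P b" for s
      using assms(1) b that unfolding subterminal_def by blast
    ultimately show "\<phi> b = \<psi> b"
      by (rule PiE_ext)
  qed
  then show ?thesis using fg by simp
qed

text \<open>Inclusion of supports suffices: any choice of sections is natural, since two sections of
  \<open>Q\<close> over one element coincide.\<close>

lemma hom_into_subterminal:
  assumes "subterminal B Q" "is_sheaf B K P" "is_sheaf B K Q"
    and nonempty: "\<And>b. b \<in> carrier B \<Longrightarrow> Sec P b \<noteq> {} \<Longrightarrow> Sec Q b \<noteq> {}"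
  shows "\<exists>f. f \<in> hom_set (sheaf_category B K) P Q"
proof -
  define \<phi> where "\<phi> = (\<lambda>b\<in>carrier B. \<lambda>s\<in>Sec P b. SOME t. t \<in> Sec Q b)"
  have \<phi>: "\<phi> b s \<in> Sec Q b" if "b \<in> carrier B" "s \<in> Sec P b" for b s
    using nonempty[of b] that by (auto simp: \<phi>_def some_in_eq)
  have P: "is_presheaf B P" and Q: "is_presheaf B Q"
    using assms(2,3) by (simp_all add: is_sheaf_def)
  have "\<phi> \<in> presheaf_morphisms B P Q"
    unfolding presheaf_morphisms_def
  proof (intro CollectI conjI ballI impI)
    show "\<phi> \<in> (\<Pi>\<^sub>E b\<in>carrier B. Sec P b \<rightarrow>\<^sub>E Sec Q b)"
      using \<phi> by (auto simp: \<phi>_def)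
    fix b c s assume a: "b \<in> carrier B" "c \<in> carrier B" "c \<sqsubseteq>\<^bsub>B\<^esub> b" "s \<in> Sec P b"
    then have "Res P b c s \<in> Sec P c" "Res Q b c (\<phi> b s) \<in> Sec Q c"
      using Res_in_Sec[OF P] Res_in_Sec[OF Q] \<phi> by simp_all
    then show "\<phi> c (Res P b c s) = Res Q b c (\<phi> b s)"
      using assms(1) a \<phi> unfolding subterminal_def by blast
  qed
  then show ?thesis
    using assms by (auto simp: hom_set_sheaf_category_iff)
qed

lemma Sec_nonempty_if_hom:
  assumes "f \<in> hom_set (sheaf_category B K) P Q" "b \<in> carrier B" "Sec P b \<noteq> {}"
  shows "Sec Q b \<noteq> {}"
proof -
  obtain \<phi> where "\<phi> \<in> presheaf_morphisms B P Q"
    using assms by (auto simp: hom_set_sheaf_category_iff)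
  then have "\<phi> b \<in> Sec P b \<rightarrow> Sec Q b"
    using assms(2) by (auto simp: presheaf_morphisms_def)
  then show ?thesis using assms(3) by auto
qed

lemma is_mono_if_subterminal:
  assumes "f \<in> hom_set (sheaf_category B K) P Q" "subterminal B P"
  shows "is_mono (sheaf_category B K) f"
  unfolding is_mono_def
proof (intro conjI ballI impI)
  show "f \<in> Arr (sheaf_category B K)"
    using assms by (auto simp: hom_set_def)
  have "Src (sheaf_category B K) f = P"
    using assms by (auto simp: hom_set_def)
  then show "h = k"
    if "h \<in> hom_set (sheaf_category B K) w (Src (sheaf_category B K) f)"
      "k \<in> hom_set (sheaf_category B K) w (Src (sheaf_category B K) f)" for w h k
    using that subterminal_hom_unique[OF assms(2)] by metis
qed

text \<open>Commutativity and uniqueness of lifts come from uniqueness of arrows into subterminal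
  sheaves. A test object \<open>w\<close>, itself an arbitrary sheaf, has its support inside those
  of \<open>P\<close> and \<open>Q\<close>, so \<open>nonempty\<close> yields the lift.\<close>

lemma is_pullback_subterminal:
  fixes B :: "'b gorder" and K :: "'b \<Rightarrow> 'b set set" and P Q R U :: "('b, 'v) presheaf"
  defines "C \<equiv> sheaf_category B K"
  assumes f: "f \<in> hom_set C P R" and g: "g \<in> hom_set C Q R"
    and p: "p \<in> hom_set C U P" and q: "q \<in> hom_set C U Q"
    and sub: "subterminal B P" "subterminal B Q" "subterminal B R" "subterminal B U"
    and nonempty:
      "\<And>b. \<lbrakk>b \<in> carrier B; Sec P b \<noteq> {}; Sec Q b \<noteq> {}\<rbrakk> \<Longrightarrow> Sec U b \<noteq> {}"
  shows "is_pullback C f g p q"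
proof -
  have cat: "is_category C"
    unfolding C_def by (rule is_category_sheaf_category)
  have st: "Src C f = P" "Tgt C f = R" "Src C g = Q" "Tgt C g = R" "Src C p = U" "Src C q = U"
      "f \<in> Arr C" "g \<in> Arr C"
    using f g p q by (auto simp: hom_set_def)
  have uniq: "k = k'" if "k \<in> hom_set C w V" "k' \<in> hom_set C w V" "subterminal B V" for k k' w V
    using that subterminal_hom_unique unfolding C_def by blast
  have "f \<odot>\<^bsub>C\<^esub> p = g \<odot>\<^bsub>C\<^esub> q"
    using comp_in_hom_set[OF cat p f] comp_in_hom_set[OF cat q g] sub uniq by blast
  moreover have "\<exists>!l. l \<in> hom_set C w U \<and> p \<odot>\<^bsub>C\<^esub> l = h \<and> q \<odot>\<^bsub>C\<^esub> l = k"
    if h: "h \<in> hom_set C w P" and k: "k \<in> hom_set C w Q" for w h k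
  proof -
    have "is_sheaf B K w" "is_sheaf B K U"
      using h p unfolding C_def by (auto simp: hom_set_sheaf_category_iff)
    then obtain l where l: "l \<in> hom_set C w U"
      using hom_into_subterminal[OF sub(4), of K w] nonempty h k Sec_nonempty_if_hom
      unfolding C_def by metis
    then have "p \<odot>\<^bsub>C\<^esub> l = h" "q \<odot>\<^bsub>C\<^esub> l = k"
      using comp_in_hom_set[OF cat l p] comp_in_hom_set[OF cat l q] h k sub uniq by blast+
    then show ?thesis using l sub uniq by blast
  qed
  ultimately show ?thesis
    unfolding is_pullback_def st using p q st by blast
qed

section \<open>Sheaves on a lattice of sets\<close>

context lattice_of_sets
begin

abbreviation Sh :: "(('a set, 'v) presheaf, ('a set, 'v) sheaf_arrow) category" where
  "Sh \<equiv> sheaf_category (set_poset F) (coherent_coverage (set_poset F))"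

abbreviation sheaf :: "('a set, 'v) presheaf \<Rightarrow> bool" where
  "sheaf \<equiv> is_sheaf (set_poset F) (coherent_coverage (set_poset F))"

abbreviation rep :: "'a set \<Rightarrow> ('a set, 'v) presheaf" where
  "rep \<equiv> representable (set_poset F)"

lemma coherent_coverage_iff:
  "S \<in> coherent_coverage (set_poset F) b \<longleftrightarrow> finite S \<and> S \<subseteq> F \<and> b = \<Union>S"
  using least_iff by (auto simp: coherent_coverage_def)

text \<open>The candidate subsheaf of the terminal sheaf with support \<open>I\<close>. Principal
  ideals give the representables; the ideal of sets avoiding a point serves to refute the strong
  property.\<close>

definition ideal_sheaf :: "'a set set \<Rightarrow> ('a set, 'v) presheaf" where
  "ideal_sheaf I = \<lparr>Sec = (\<lambda>c. if c \<in> I then {undefined} else {}), Res = (\<lambda>_ _ s. s)\<rparr>"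

lemma Sec_ideal_sheaf [simp]: "Sec (ideal_sheaf I) c = (if c \<in> I then {undefined} else {})"
  by (simp add: ideal_sheaf_def)

lemma rep_eq_ideal_sheaf: "rep b = ideal_sheaf {c. c \<subseteq> b}"
  by (simp add: representable_def ideal_sheaf_def)

lemma subterminal_ideal_sheaf: "subterminal (set_poset F) (ideal_sheaf I)"
  by (auto simp: subterminal_def)

text \<open>Closure under subsets provides restrictions, closure under finite unions provides
  gluing, and the only possible section is \<open>undefined\<close>. The case \<open>S = {}\<close>
  of \<open>Union\<close> matches the empty cover of \<open>{}\<close>.\<close>

lemma sheaf_ideal_sheaf:
  fixes I :: "'a set set"
  assumes down: "\<And>a b. \<lbrakk>b \<in> I; a \<subseteq> b\<rbrakk> \<Longrightarrow> a \<in> I"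
    and Union: "\<And>S. \<lbrakk>finite S; S \<subseteq> I\<rbrakk> \<Longrightarrow> \<Union>S \<in> I"
  shows "sheaf (ideal_sheaf I :: ('a set, 'v) presheaf)"
  unfolding is_sheaf_def
proof (intro conjI ballI allI impI)
  let ?P = "ideal_sheaf I :: ('a set, 'v) presheaf"
  show "is_presheaf (set_poset F) ?P"
    using down by (auto simp: is_presheaf_def ideal_sheaf_def)
  fix b S s
  assume S: "S \<in> coherent_coverage (set_poset F) b" and s: "matching_family (set_poset F) ?P S s"
  have sS: "c \<in> I \<and> s c = undefined" if "c \<in> S" for c
    using s that by (auto simp: matching_family_def split: if_splits)
  then have "b \<in> I"
    using S Union[of S] by (auto simp: coherent_coverage_iff)
  then show "\<exists>!t. t \<in> Sec ?P b \<and> (\<forall>c\<in>S. Res ?P b c t = s c)"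
    using sS by (auto simp: ideal_sheaf_def)
qed

lemma subterminal_rep: "subterminal (set_poset F) (rep b)"
  unfolding rep_eq_ideal_sheaf by (rule subterminal_ideal_sheaf)

lemma sheaf_rep: "sheaf (rep b)"
  unfolding rep_eq_ideal_sheaf by (rule sheaf_ideal_sheaf) auto

lemma Sec_rep: "Sec (rep b) c = (if c \<subseteq> b then {undefined} else {})"
  by (simp add: rep_eq_ideal_sheaf)

text \<open>The Yoneda lemma: the arrow has value \<open>Res P b c s\<close> over \<open>c\<close>,
  and evaluation at \<open>undefined\<close>, the only section of \<open>rep b\<close> over
  \<open>b\<close>, returns \<open>s\<close>. It turns statements on arrows into statements on
  sections.\<close>

lemma yoneda_hom:
  fixes P :: "('a set, 'v) presheaf"
  assumes P: "sheaf P" and b: "b \<in> F" "s \<in> Sec P b"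
  shows "\<exists>f. f \<in> hom_set Sh (rep b) P \<and> snd (snd f) b undefined = s"
proof -
  define \<phi> where "\<phi> = (\<lambda>c\<in>F. \<lambda>_\<in>Sec (rep b :: ('a set, 'v) presheaf) c. Res P b c s)"
  have pre: "is_presheaf (set_poset F) P"
    using P by (simp add: is_sheaf_def)
  have "\<phi> \<in> presheaf_morphisms (set_poset F) (rep b) P"
  proof -
    have "Res P b c s \<in> Sec P c" if "c \<in> F" "c \<subseteq> b" for c
      using Res_in_Sec[OF pre] that b by auto
    moreover have "Res P c d (Res P b c s) = Res P b d s" if "c \<in> F" "d \<in> F" "d \<subseteq> c" "c \<subseteq> b" for c d
      using pre that b by (auto simp: is_presheaf_def)
    ultimately show ?thesis
      unfolding presheaf_morphisms_def \<phi>_def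
      by (auto simp: Sec_rep representable_def split: if_splits)
  qed
  moreover have "\<phi> b undefined = s"
    using pre b by (auto simp: \<phi>_def Sec_rep is_presheaf_def)
  ultimately show ?thesis
    using P sheaf_rep
    by (intro exI[of _ "(rep b, P, \<phi>)"]) (auto simp: hom_set_sheaf_category_iff)
qed

text \<open>Two different sections of the source would be two parallel arrows from a representable.\<close>

lemma subterminal_Src_if_mono:
  fixes Q :: "('a set, 'v) presheaf"
  assumes m: "is_mono Sh m" "m \<in> hom_set Sh P Q" and Q: "subterminal (set_poset F) Q"
  shows "subterminal (set_poset F) P"
  unfolding subterminal_def
proof (intro ballI)
  fix b s t assume b: "b \<in> carrier (set_poset F)" and st: "s \<in> Sec P b" "t \<in> Sec P b"
  have P: "sheaf P" using m by (auto simp: hom_set_sheaf_category_iff)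
  obtain f g where f: "f \<in> hom_set Sh (rep b) P" "snd (snd f) b undefined = s"
    and g: "g \<in> hom_set Sh (rep b) P" "snd (snd g) b undefined = t"
    using yoneda_hom[OF P] b st by (metis set_poset_simps(1))
  have "m \<odot>\<^bsub>Sh\<^esub> f = m \<odot>\<^bsub>Sh\<^esub> g"
    by (rule subterminal_hom_unique[OF Q]) (rule comp_in_hom_set[OF is_category_sheaf_category] f m g)+
  moreover have "Src Sh m = P"
    using m by (auto simp: hom_set_def)
  moreover have "rep b \<in> Obj Sh"
    using sheaf_rep by simp
  ultimately have "f = g"
    using m(1) f(1) g(1) unfolding is_mono_def by blast
  then show "s = t" using f g by simp
qed

section \<open>Factorizations and gluing in terms of supports\<close>

lemma on_arr_yoneda_in_hom_set:
  assumes "a \<in> F" "b \<in> F" "a \<subseteq> b"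
  shows "on_arr (yoneda (set_poset F)) (a, b) \<in> hom_set Sh (rep a) (rep b)"
  using assms sheaf_rep
  by (auto simp: yoneda_def hom_set_sheaf_category_iff presheaf_morphisms_def Sec_rep
      representable_def split: if_splits)

text \<open>Inclusion of supports gives an arrow between the sources, and the triangle commutes
  because \<open>R\<close> is subterminal.\<close>

lemma factors_through_subterminal:
  assumes f: "f \<in> hom_set Sh P R" and m: "m \<in> hom_set Sh Q R"
    and "subterminal (set_poset F) Q" "subterminal (set_poset F) R"
    and "\<And>b. \<lbrakk>b \<in> F; Sec P b \<noteq> {}\<rbrakk> \<Longrightarrow> Sec Q b \<noteq> {}"
  shows "factors_through Sh f m"
proof -
  have "sheaf P" "sheaf Q"
    using f m by (auto simp: hom_set_sheaf_category_iff)
  then obtain h where h: "h \<in> hom_set Sh P Q"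
    using hom_into_subterminal[of "set_poset F" Q] assms by (metis set_poset_simps(1))
  have "m \<odot>\<^bsub>Sh\<^esub> h = f"
    using comp_in_hom_set[OF is_category_sheaf_category h m] f assms(4) subterminal_hom_unique
    by blast
  moreover have "Src Sh f = P" "Src Sh m = Q"
    using f m by (auto simp: hom_set_def)
  ultimately show ?thesis using h unfolding factors_through_def by blast
qed

lemma Sec_nonempty_if_factors_through:
  assumes "factors_through Sh f m" "b \<in> F" "Sec (Src Sh f) b \<noteq> {}"
  shows "Sec (Src Sh m) b \<noteq> {}"
  using assms Sec_nonempty_if_hom unfolding factors_through_def
  by (metis set_poset_simps(1))

text \<open>Sections chosen over the members agree on overlaps, where there is only one section, and
  therefore glue along the finite cover \<open>S\<close>.\<close>

lemma Sec_Union_nonempty: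
  assumes P: "sheaf P" "subterminal (set_poset F) P"
    and S: "finite S" "S \<subseteq> F" "\<And>c. c \<in> S \<Longrightarrow> Sec P c \<noteq> {}"
  shows "Sec P (\<Union>S) \<noteq> {}"
proof -
  define s where "s c = (SOME t. t \<in> Sec P c)" for c
  have s: "s c \<in> Sec P c" if "c \<in> S" for c
    using S(3)[OF that] by (auto simp: s_def some_in_eq)
  have pre: "is_presheaf (set_poset F) P"
    using P(1) by (simp add: is_sheaf_def)
  have Res: "Res P c d (s c) \<in> Sec P d" if "c \<in> S" "d \<in> F" "d \<subseteq> c" for c d
    using Res_in_Sec[OF pre] s that S by auto
  have "matching_family (set_poset F) P S s"
    unfolding matching_family_def
    using s Res P(2) by (auto simp: subterminal_def)
  moreover have "S \<in> coherent_coverage (set_poset F) (\<Union>S)" "\<Union>S \<in> F"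
    using S Union_in by (auto simp: coherent_coverage_iff)
  ultimately show ?thesis
    using P(1) unfolding is_sheaf_def by (metis empty_iff set_poset_simps(1))
qed

end

section \<open>Homomorphisms of lattices of sets as coherent functors\<close>

text \<open>The categorical arguments are carried out for any homomorphism \<open>h\<close>; taking
  interiors enters in the final part.\<close>

locale lattice_of_sets_hom = dom: lattice_of_sets G S + lattice_of_sets F T
  for G :: "'b set set" and S and F :: "'a set set" and T +
  fixes h :: "'b set \<Rightarrow> 'a set"
  assumes hom_in: "A \<in> G \<Longrightarrow> h A \<in> F"
    and hom_top: "h S = T"
    and hom_empty: "h {} = {}"
    and hom_Un: "\<lbrakk>A \<in> G; B \<in> G\<rbrakk> \<Longrightarrow> h (A \<union> B) = h A \<union> h B"
    and hom_Int: "\<lbrakk>A \<in> G; B \<in> G\<rbrakk> \<Longrightarrow> h (A \<inter> B) = h A \<inter> h B"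
begin

lemma hom_mono: "\<lbrakk>A \<in> G; B \<in> G; A \<subseteq> B\<rbrakk> \<Longrightarrow> h A \<subseteq> h B"
  using hom_Int[of A B] by (auto simp: inf.absorb1)

lemma hom_Union: "\<lbrakk>finite I; I \<subseteq> G\<rbrakk> \<Longrightarrow> h (\<Union>I) = \<Union>(h ` I)"
  by (induction I rule: finite_induct) (auto simp: hom_empty hom_Un dom.Union_in)

lemma bounded_lattice_hom: "bounded_lattice_hom (set_poset G) (set_poset F) h"
  unfolding bounded_lattice_hom_def join_pres_def meet_pres_def
  by (auto simp: dom.bounded_lattice_set_poset bounded_lattice_set_poset
      dom.lattice_set_poset lattice_set_poset hom_in hom_Un hom_Int hom_top hom_empty
      dom.join_eq join_eq dom.meet_eq meet_eq dom.top_eq top_eq dom.bottom_eq bottom_eq)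

definition hom_functor ::
  "('b set, 'b set \<times> 'b set, ('a set, 'v) presheaf, ('a set, 'v) sheaf_arrow) fnctr" where
  "hom_functor = comp_functor (yoneda (set_poset F)) (poset_functor h)"

lemma on_obj_hom_functor [simp]: "on_obj hom_functor A = rep (h A)"
  by (simp add: hom_functor_def comp_functor_def yoneda_def poset_functor_def)

lemma on_arr_hom_functor_pair:
  "on_arr hom_functor (A, B) = on_arr (yoneda (set_poset F)) (h A, h B)"
  by (simp add: hom_functor_def comp_functor_def poset_functor_def)

lemma on_arr_hom_functor:
  assumes "f \<in> Arr dom.Pos"
  shows "on_arr hom_functor f \<in> hom_set Sh (rep (h (fst f))) (rep (h (snd f)))"
proof -
  obtain A B where f: "f = (A, B)" by (cases f)
  show ?thesis
    unfolding f on_arr_hom_functor_pair fst_conv snd_conv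
    by (rule on_arr_yoneda_in_hom_set) (use assms hom_in hom_mono in \<open>auto simp: f\<close>)
qed

lemma rep_hom_unique:
  "\<lbrakk>f \<in> hom_set Sh P (rep b); g \<in> hom_set Sh P (rep b)\<rbrakk> \<Longrightarrow> f = g"
  by (rule subterminal_hom_unique[OF subterminal_rep])

text \<open>Both functor laws compare parallel arrows into a representable, which is
  subterminal.\<close>

lemma is_functor_hom_functor: "is_functor dom.Pos Sh hom_functor" (is "is_functor _ ?C ?M")
  unfolding is_functor_def
proof (intro conjI ballI impI)
  show "is_category dom.Pos" "is_category ?C"
    by (rule dom.is_category_Pos is_category_sheaf_category)+
  show "on_obj ?M x \<in> Obj ?C" for x
    using sheaf_rep by simp
next
  fix f assume "f \<in> Arr dom.Pos"
  then show "on_arr ?M f \<in>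
      hom_set ?C (on_obj ?M (Src dom.Pos f)) (on_obj ?M (Tgt dom.Pos f))"
    using on_arr_hom_functor by simp
next
  fix x assume "x \<in> Obj dom.Pos"
  then have "on_arr ?M (x, x) \<in> hom_set ?C (rep (h x)) (rep (h x))"
    using on_arr_hom_functor[of "(x, x)"] by simp
  moreover have "Idt ?C (rep (h x)) \<in> hom_set ?C (rep (h x)) (rep (h x))"
    using is_category_sheaf_category sheaf_rep unfolding is_category_def by force
  ultimately show "on_arr ?M (Idt dom.Pos x) = Idt ?C (on_obj ?M x)"
    using rep_hom_unique by simp
next
  fix f g assume fg: "f \<in> Arr dom.Pos" "g \<in> Arr dom.Pos" "Tgt dom.Pos f = Src dom.Pos g"
  show "on_arr ?M (g \<odot>\<^bsub>dom.Pos\<^esub> f) = on_arr ?M g \<odot>\<^bsub>?C\<^esub> on_arr ?M f"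
  proof (rule rep_hom_unique)
    have "g \<odot>\<^bsub>dom.Pos\<^esub> f \<in> Arr dom.Pos"
      using fg by auto blast
    from on_arr_hom_functor[OF this]
    show "on_arr ?M (g \<odot>\<^bsub>dom.Pos\<^esub> f) \<in> hom_set ?C (rep (h (fst f))) (rep (h (snd g)))"
      by simp
    show "on_arr ?M g \<odot>\<^bsub>?C\<^esub> on_arr ?M f \<in>
        hom_set ?C (rep (h (fst f))) (rep (h (snd g)))"
      using comp_in_hom_set[OF is_category_sheaf_category]
        on_arr_hom_functor[OF fg(1)] on_arr_hom_functor[OF fg(2)] fg(3) by simp
  qed
qed

section \<open>Preservation of monomorphisms, finite limits, images and unions\<close>

lemma is_mono_hom_functor: "f \<in> Arr dom.Pos \<Longrightarrow> is_mono Sh (on_arr hom_functor f)"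
  using is_mono_if_subterminal on_arr_hom_functor subterminal_rep by blast

lemma on_arr_hom_functor_hom:
  assumes "s \<in> subobjects dom.Pos x"
  shows "on_arr hom_functor s \<in> hom_set Sh (rep (h (fst s))) (rep (h x))"
proof -
  have "s \<in> Arr dom.Pos" "snd s = x"
    using assms by (auto simp: subobjects_def dom.is_mono_Pos_iff)
  then show ?thesis
    using on_arr_hom_functor by blast
qed

lemma on_arr_hom_functor_subobject:
  assumes "s \<in> subobjects dom.Pos x"
  shows "on_arr hom_functor s \<in> subobjects Sh (rep (h x))"
  using is_mono_if_subterminal[OF on_arr_hom_functor_hom[OF assms] subterminal_rep]
    on_arr_hom_functor_hom[OF assms]
  unfolding subobjects_def hom_set_def by blast

lemma is_terminal_rep_top: "is_terminal Sh (rep T)"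
  unfolding is_terminal_def
proof (intro conjI ballI)
  show "rep T \<in> Obj Sh"
    using sheaf_rep by simp
  fix P :: "('a set, 'c) presheaf" assume "P \<in> Obj Sh"
  then have "\<exists>f. f \<in> hom_set Sh P (rep T)"
    using subset_top by (intro hom_into_subterminal subterminal_rep sheaf_rep) (auto simp: Sec_rep)
  then show "\<exists>!f. f \<in> hom_set Sh P (rep T)"
    using rep_hom_unique by blast
qed

text \<open>The supports fit because a set contained in \<open>h a\<close> and in \<open>h b\<close>
  is contained in \<open>h (a \<inter> b)\<close>.\<close>

lemma is_pullback_hom_functor:
  assumes "is_pullback dom.Pos f g p q"
  shows "is_pullback Sh (on_arr hom_functor f) (on_arr hom_functor g)
    (on_arr hom_functor p) (on_arr hom_functor q)"
    (is "is_pullback ?C (on_arr ?M f) _ _ _")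
proof -
  obtain a b c where abc: "a \<in> G" "b \<in> G" "c \<in> G" "a \<subseteq> c" "b \<subseteq> c"
    and eq: "f = (a, c)" "g = (b, c)" "p = (a \<inter> b, a)" "q = (a \<inter> b, b)"
    using assms by (auto simp: dom.is_pullback_Pos_iff)
  have "f \<in> Arr dom.Pos" "g \<in> Arr dom.Pos" "p \<in> Arr dom.Pos" "q \<in> Arr dom.Pos"
    using abc by (auto simp: eq)
  then have homs: "on_arr ?M f \<in> hom_set ?C (rep (h a)) (rep (h c))"
    "on_arr ?M g \<in> hom_set ?C (rep (h b)) (rep (h c))"
    "on_arr ?M p \<in> hom_set ?C (rep (h (a \<inter> b))) (rep (h a))"
    "on_arr ?M q \<in> hom_set ?C (rep (h (a \<inter> b))) (rep (h b))"
    using on_arr_hom_functor eq by fastforce+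
  show ?thesis
    by (rule is_pullback_subterminal[OF homs])
      (auto simp: subterminal_rep Sec_rep hom_Int abc split: if_splits)
qed

text \<open>Images in the poset are trivial, and the functor sends arrows to monomorphisms, which
  are their own images.\<close>

lemma is_image_hom_functor:
  assumes "is_image dom.Pos f m"
  shows "is_image Sh (on_arr hom_functor f) (on_arr hom_functor m)"
    (is "is_image ?C (on_arr ?M f) _")
proof -
  have f: "f \<in> Arr dom.Pos" and m: "m = f"
    using assms by (auto simp: dom.is_image_Pos_iff)
  have hom: "on_arr ?M f \<in> hom_set ?C (rep (h (fst f))) (rep (h (snd f)))"
    using on_arr_hom_functor[OF f] .
  have "factors_through ?C (on_arr ?M f) (on_arr ?M f)"
    using factors_through_subterminal[OF hom hom] subterminal_rep by blast
  then show ?thesis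
    unfolding m is_image_def
    using is_mono_hom_functor[OF f] hom by (auto simp: subobjects_def hom_set_def)
qed

text \<open>For leastness, an upper bound \<open>N\<close> has sections over each
  \<open>h (fst i)\<close>. These glue over the finite union \<open>h (fst m)\<close>, and
  restriction reaches everything below it.\<close>

lemma is_union_hom_functor:
  assumes I: "finite I" and union: "is_union dom.Pos x I m"
  shows "is_union Sh (rep (h x)) (on_arr hom_functor ` I) (on_arr hom_functor m)"
    (is "is_union ?C ?R (on_arr ?M ` I) _")
  unfolding is_union_def
proof (intro conjI ballI impI)
  have x: "x \<in> G" and sub: "I \<subseteq> subobjects dom.Pos x" and m: "m = (\<Union>(fst ` I), x)"
    using dom.is_union_Pos_iff[OF I] union by auto
  have fst_in: "fst ` I \<subseteq> G"
    using sub dom.subobjects_Pos_iff by auto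
  have m_sub: "m \<in> subobjects dom.Pos x"
    using union by (simp add: is_union_def)
  have h_m: "h (fst m) = \<Union>(h ` fst ` I)"
    using hom_Union[of "fst ` I"] I fst_in m by simp
  show "?R \<in> Obj ?C"
    using sheaf_rep by simp
  show "on_arr ?M ` I \<subseteq> subobjects ?C ?R"
    using sub on_arr_hom_functor_subobject by blast
  show "on_arr ?M m \<in> subobjects ?C ?R"
    using m_sub on_arr_hom_functor_subobject by blast
  show "factors_through ?C s (on_arr ?M m)" if s: "s \<in> on_arr ?M ` I" for s
  proof -
    obtain i where i: "i \<in> I" and s_eq: "s = on_arr ?M i"
      using s by blast
    have hom: "s \<in> hom_set ?C (rep (h (fst i))) ?R"
      using i s_eq sub on_arr_hom_functor_hom by blast
    have "h (fst i) \<subseteq> h (fst m)"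
      using i h_m by auto
    then show ?thesis
      by (intro factors_through_subterminal[OF hom on_arr_hom_functor_hom[OF m_sub]]
          subterminal_rep) (auto simp: Sec_rep split: if_splits)
  qed
  show "factors_through ?C (on_arr ?M m) n"
    if n: "n \<in> subobjects ?C ?R" and ub: "\<forall>s\<in>on_arr ?M ` I. factors_through ?C s n" for n
  proof -
    define N where "N = Src ?C n"
    have n_hom: "n \<in> hom_set ?C N ?R" and n_mono: "is_mono ?C n"
      using n by (auto simp: subobjects_def hom_set_def is_mono_def N_def)
    have N: "sheaf N"
      using n_hom by (simp add: hom_set_sheaf_category_iff)
    \<comment> \<open>As the source of a monomorphism into a representable, \<open>N\<close> is
      determined by its support.\<close>
    have N_sub: "subterminal (set_poset F) N"
      using subterminal_Src_if_mono[OF n_mono n_hom subterminal_rep] .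
    have "Sec N (h (fst i)) \<noteq> {}" if i: "i \<in> I" for i
    proof -
      have "on_arr ?M i \<in> hom_set ?C (rep (h (fst i))) ?R"
        using i sub on_arr_hom_functor_hom by blast
      then have src: "Src ?C (on_arr ?M i) = rep (h (fst i))"
        by (simp add: hom_set_def)
      have ft: "factors_through ?C (on_arr ?M i) n"
        using i ub by blast
      have "h (fst i) \<in> F"
        using i fst_in hom_in by blast
      from Sec_nonempty_if_factors_through[OF ft this] src show ?thesis
        by (simp add: N_def Sec_rep)
    qed
    then have "Sec N (h (fst m)) \<noteq> {}"
      unfolding h_m using I fst_in hom_in by (intro Sec_Union_nonempty[OF N N_sub]) auto
    then have "Sec N b \<noteq> {}" if "b \<in> F" "b \<subseteq> h (fst m)" for b
    proof -
      have "h (fst m) \<in> F"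
        using m_sub dom.subobjects_Pos_iff hom_in by blast
      then show ?thesis
        using that N \<open>Sec N (h (fst m)) \<noteq> {}\<close> Res_in_Sec[of "set_poset F" N "h (fst m)" b]
        by (fastforce simp: is_sheaf_def)
    qed
    then show ?thesis
      by (intro factors_through_subterminal[OF on_arr_hom_functor_hom[OF m_sub] n_hom]
          N_sub subterminal_rep) (auto simp: Sec_rep split: if_splits)
  qed
qed

theorem coherent_functor_hom_functor: "coherent_functor dom.Pos Sh hom_functor"
  unfolding coherent_functor_def
  using dom.coherent_category_Pos is_functor_hom_functor is_pullback_hom_functor
    is_image_hom_functor is_union_hom_functor is_terminal_rep_top
  by (auto simp: dom.is_terminal_Pos_iff hom_top)

section \<open>Positive closedness\<close>

text \<open>The arrow from \<open>A\<close> to the top \<open>S\<close> has a trivial kernel pair,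
  which \<open>N\<close> preserves; so \<open>N A\<close> embeds into the terminal sheaf
  \<open>N S\<close>.\<close>

lemma subterminal_coherent_functor:
  fixes N :: "('b set, 'b set \<times> 'b set, ('a set, 'v) presheaf, ('a set, 'v) sheaf_arrow) fnctr"
  assumes N: "coherent_functor dom.Pos Sh N" and A: "A \<in> G"
  shows "subterminal (set_poset F) (on_obj N A)"
proof -
  have N_fun: "is_functor dom.Pos Sh N" and N_top: "is_terminal Sh (on_obj N S)"
    using N by (auto simp: coherent_functor_def dom.is_terminal_Pos_iff)
  have arr: "(A, S) \<in> Arr dom.Pos"
    using A dom.subset_top by auto
  then have hom: "on_arr N (A, S) \<in> hom_set Sh (on_obj N A) (on_obj N S)"
    using N_fun unfolding is_functor_def by force
  have "is_pullback dom.Pos (A, S) (A, S) (A, A) (A, A)"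
    using arr by (auto simp: dom.is_pullback_Pos_iff)
  then have "is_pullback Sh (on_arr N (A, S)) (on_arr N (A, S)) (on_arr N (A, A)) (on_arr N (A, A))"
    using N unfolding coherent_functor_def by blast
  moreover have "on_arr N (A, A) = Idt Sh (on_obj N A)"
    using N_fun A unfolding is_functor_def by (metis dom.Pos_simps(1,5))
  ultimately have mono: "is_mono Sh (on_arr N (A, S))"
    using hom by (intro is_mono_if_kernel_pair_trivial[OF _ _ is_category_sheaf_category])
      (auto simp: hom_set_def)
  \<comment> \<open>Sections of \<open>N S\<close> correspond to arrows from representables, and
    arrows into a terminal object are unique.\<close>
  have "subterminal (set_poset F) (on_obj N S)"
    unfolding subterminal_def
  proof (intro ballI)
    fix b s t
    assume b: "b \<in> carrier (set_poset F)" and st: "s \<in> Sec (on_obj N S) b" "t \<in> Sec (on_obj N S) b"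
    have "sheaf (on_obj N S)"
      using hom by (simp add: hom_set_sheaf_category_iff)
    then obtain f g where fg: "f \<in> hom_set Sh (rep b) (on_obj N S)" "snd (snd f) b undefined = s"
      "g \<in> hom_set Sh (rep b) (on_obj N S)" "snd (snd g) b undefined = t"
      using yoneda_hom b st by (metis set_poset_simps(1))
    have "rep b \<in> Obj Sh"
      using sheaf_rep by simp
    then have "f = g"
      using N_top fg unfolding is_terminal_def by blast
    then show "s = t"
      using fg by simp
  qed
  then show ?thesis
    using subterminal_Src_if_mono[OF mono hom] by blast
qed

text \<open>As the empty union in \<open>S\<close>, \<open>{}\<close> is sent to the least subobject
  of the terminal sheaf, which lies below \<open>rep {}\<close>. A section over \<open>{}\<close>
  itself is not excluded: the empty cover forces one.\<close>

lemma coherent_functor_empty_Sec: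
  fixes N :: "('b set, 'b set \<times> 'b set, ('a set, 'v) presheaf, ('a set, 'v) sheaf_arrow) fnctr"
  assumes N: "coherent_functor dom.Pos Sh N" and b: "b \<in> F" "Sec (on_obj N {}) b \<noteq> {}"
  shows "b = {}"
proof -
  have N_top: "is_terminal Sh (on_obj N S)" and N_fun: "is_functor dom.Pos Sh N"
    using N by (auto simp: coherent_functor_def dom.is_terminal_Pos_iff)
  have "is_union dom.Pos S {} ({}, S)"
    by (simp add: dom.is_union_Pos_iff)
  then have union: "is_union Sh (on_obj N S) {} (on_arr N ({}, S))"
    using N unfolding coherent_functor_def by (metis finite.emptyI image_empty)
  have "rep {} \<in> Obj Sh"
    using sheaf_rep by simp
  then obtain n where n: "n \<in> hom_set Sh (rep {}) (on_obj N S)"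
    using N_top unfolding is_terminal_def by blast
  then have "n \<in> subobjects Sh (on_obj N S)"
    using is_mono_if_subterminal[OF n subterminal_rep] by (simp add: subobjects_def hom_set_def)
  then have ft: "factors_through Sh (on_arr N ({}, S)) n"
    using union by (simp add: is_union_def)
  have "on_arr N ({}, S) \<in> hom_set Sh (on_obj N {}) (on_obj N S)"
    using N_fun unfolding is_functor_def by force
  then have "Src Sh (on_arr N ({}, S)) = on_obj N {}" "Src Sh n = rep {}"
    using n by (auto simp: hom_set_def)
  then have "Sec (rep {} :: ('a set, 'v) presheaf) b \<noteq> {}"
    using Sec_nonempty_if_factors_through[OF ft b(1)] b(2) by simp
  then show ?thesis
    by (simp add: Sec_rep split: if_splits)
qed

text \<open>If \<open>N C\<close> had a section over some \<open>b\<close> outside \<open>h C\<close>, it would meet \<open>N E\<close>, which contains \<open>h E\<close>,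
  for an \<open>E\<close> disjoint from \<open>C\<close>; but \<open>N C\<close> and \<open>N E\<close> intersect in \<open>N {} = 0\<close>.\<close>

lemma Sec_le_hom_if_natural:
  fixes N :: "('b set, 'b set \<times> 'b set, ('a set, 'v) presheaf, ('a set, 'v) sheaf_arrow) fnctr"
  assumes sep: "\<And>C b. \<lbrakk>C \<in> G; b \<in> F; \<not> b \<subseteq> h C\<rbrakk> \<Longrightarrow> \<exists>E\<in>G. E \<inter> C = {} \<and> h E \<inter> b \<noteq> {}"
    and N: "coherent_functor dom.Pos Sh N"
    and \<eta>: "is_natural_transformation dom.Pos Sh hom_functor N \<eta>"
    and C: "C \<in> G" and b: "b \<in> F" and sec: "Sec (on_obj N C) b \<noteq> {}"
  shows "b \<subseteq> h C"
proof (rule ccontr)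
  assume "\<not> b \<subseteq> h C"
  then obtain E where E: "E \<in> G" "E \<inter> C = {}" "h E \<inter> b \<noteq> {}"
    using sep C b by blast
  \<comment> \<open>Inside \<open>h E\<close>, \<eta> supplies a section of \<open>N E\<close>;
    inside \<open>b\<close>, the given section of \<open>N C\<close> restricts. Both are available
    over \<open>d\<close>.\<close>
  define d where "d = h E \<inter> b"
  have d: "d \<in> F" "d \<subseteq> b" "d \<subseteq> h E"
    using E b hom_in by (auto simp: d_def)
  have N_fun: "is_functor dom.Pos Sh N" and N_top: "is_terminal Sh (on_obj N S)"
    using N by (auto simp: coherent_functor_def dom.is_terminal_Pos_iff)
  have "\<eta> E \<in> hom_set Sh (rep (h E)) (on_obj N E)"
    using \<eta> E(1) unfolding is_natural_transformation_def by simp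
  moreover have "Sec (rep (h E) :: ('a set, 'v) presheaf) d \<noteq> {}"
    using d by (simp add: Sec_rep)
  ultimately obtain t where t: "t \<in> Sec (on_obj N E) d"
    using Sec_nonempty_if_hom d(1) by (metis all_not_in_conv set_poset_simps(1))
  have N_sheaf: "sheaf (on_obj N A)" if "A \<in> G" for A
    using N_fun that unfolding is_functor_def by auto
  obtain s where "s \<in> Sec (on_obj N C) b"
    using sec by blast
  then have s: "Res (on_obj N C) b d s \<in> Sec (on_obj N C) d"
    using N_sheaf[OF C] b d Res_in_Sec[of "set_poset F" "on_obj N C" b d s] by (simp add: is_sheaf_def)
  obtain k l where k: "k \<in> hom_set Sh (rep d) (on_obj N C)" and l: "l \<in> hom_set Sh (rep d) (on_obj N E)"
    using yoneda_hom[OF N_sheaf[OF C] d(1) s] yoneda_hom[OF N_sheaf[OF E(1)] d(1) t] by blast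
  \<comment> \<open>As \<open>C\<close> and \<open>E\<close> are disjoint, their pullback over
    \<open>S\<close> has apex \<open>{}\<close>. Its image under \<open>N\<close> is again a
    pullback, which turns \<open>k\<close> and \<open>l\<close> into an arrow to
    \<open>N {}\<close>.\<close>
  have "is_pullback dom.Pos (C, S) (E, S) ({}, C) ({}, E)"
    using C E dom.subset_top unfolding dom.is_pullback_Pos_iff
    by (intro bexI[of _ C] bexI[of _ E] bexI[of _ S]) auto
  then have pb: "is_pullback Sh (on_arr N (C, S)) (on_arr N (E, S)) (on_arr N ({}, C)) (on_arr N ({}, E))"
    using N unfolding coherent_functor_def by blast
  have arr: "(C, S) \<in> Arr dom.Pos" "(E, S) \<in> Arr dom.Pos" "({}, C) \<in> Arr dom.Pos"
    using C E dom.subset_top by auto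
  then have homs: "on_arr N (C, S) \<in> hom_set Sh (on_obj N C) (on_obj N S)"
    "on_arr N (E, S) \<in> hom_set Sh (on_obj N E) (on_obj N S)"
    "on_arr N ({}, C) \<in> hom_set Sh (on_obj N {}) (on_obj N C)"
    using N_fun unfolding is_functor_def by force+
  have d_Obj: "rep d \<in> Obj Sh"
    using sheaf_rep by simp
  \<comment> \<open>Both composites end in the terminal object \<open>N S\<close>.\<close>
  have "on_arr N (C, S) \<odot>\<^bsub>Sh\<^esub> k = on_arr N (E, S) \<odot>\<^bsub>Sh\<^esub> l"
    using comp_in_hom_set[OF is_category_sheaf_category k homs(1)]
      comp_in_hom_set[OF is_category_sheaf_category l homs(2)] N_top d_Obj
    unfolding is_terminal_def by blast
  moreover have "Src Sh (on_arr N (C, S)) = on_obj N C" "Src Sh (on_arr N (E, S)) = on_obj N E"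
    "Src Sh (on_arr N ({}, C)) = on_obj N {}"
    using homs by (simp_all add: hom_set_def)
  ultimately obtain j where "j \<in> hom_set Sh (rep d) (on_obj N {})"
    using is_pullback_lift[OF pb d_Obj] k l by metis
  moreover have "Sec (rep d :: ('a set, 'v) presheaf) d \<noteq> {}"
    by (simp add: Sec_rep)
  ultimately have "Sec (on_obj N {}) d \<noteq> {}"
    using Sec_nonempty_if_hom d(1) by (metis set_poset_simps(1))
  then have "d = {}"
    using coherent_functor_empty_Sec[OF N d(1)] by blast
  then show False
    using E by (simp add: d_def)
qed

text \<open>The condition \<open>sep\<close> makes \<open>h C\<close> the largest element of
  \<open>F\<close> disjoint from all \<open>h E\<close> with \<open>E\<close> disjoint from
  \<open>C\<close>. This confines the support of \<open>N C\<close> to the subsets of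
  \<open>h C\<close>, and the naturality square is a pullback by comparison of supports.\<close>

theorem positively_closed_hom_functor:
  assumes sep: "\<And>C b. \<lbrakk>C \<in> G; b \<in> F; \<not> b \<subseteq> h C\<rbrakk> \<Longrightarrow> \<exists>E\<in>G. E \<inter> C = {} \<and> h E \<inter> b \<noteq> {}"
  shows "positively_closed dom.Pos Sh
    (hom_functor :: ('b set, 'b set \<times> 'b set, ('a set, 'v) presheaf, ('a set, 'v) sheaf_arrow) fnctr)"
  unfolding positively_closed_def is_elementary_def
proof (intro allI impI)
  fix N :: "('b set, 'b set \<times> 'b set, ('a set, 'v) presheaf, ('a set, 'v) sheaf_arrow) fnctr"
  fix \<eta> u
  assume "coherent_functor dom.Pos Sh N \<and> is_natural_transformation dom.Pos Sh hom_functor N \<eta>"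
  then have N: "coherent_functor dom.Pos Sh N"
    and \<eta>: "is_natural_transformation dom.Pos Sh hom_functor N \<eta>"
    by auto
  assume "is_mono dom.Pos u"
  then have u: "u \<in> Arr dom.Pos"
    by (simp add: dom.is_mono_Pos_iff)
  then obtain C D where u_eq: "u = (C, D)" and CD: "C \<in> G" "D \<in> G"
    by auto
  have N_u: "on_arr N u \<in> hom_set Sh (on_obj N C) (on_obj N D)"
    using N u unfolding coherent_functor_def is_functor_def u_eq by force
  have \<eta>_hom: "\<eta> A \<in> hom_set Sh (rep (h A)) (on_obj N A)" if "A \<in> G" for A
    using \<eta> that unfolding is_natural_transformation_def by simp
  have M_u: "on_arr hom_functor u \<in> hom_set Sh (rep (h C)) (rep (h D))"
    using on_arr_hom_functor[OF u] by (simp add: u_eq)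
  have "is_pullback Sh (on_arr N u) (\<eta> D) (\<eta> C) (on_arr hom_functor u)"
  proof (rule is_pullback_subterminal[OF N_u \<eta>_hom[OF CD(2)] \<eta>_hom[OF CD(1)] M_u])
    fix b assume "b \<in> carrier (set_poset F)" "Sec (on_obj N C) b \<noteq> {}"
    then show "Sec (rep (h C) :: ('a set, 'v) presheaf) b \<noteq> {}"
      using Sec_le_hom_if_natural[OF sep N \<eta> CD(1)] by (simp add: Sec_rep)
  qed (use subterminal_rep subterminal_coherent_functor[OF N] CD in auto)
  then show "is_pullback Sh (on_arr N u) (\<eta> (Tgt dom.Pos u)) (\<eta> (Src dom.Pos u)) (on_arr hom_functor u)"
    by (simp add: u_eq)
qed

section \<open>Failure of strong positive closedness\<close>

text \<open>Covers are finite, so the elements of the lattice that avoid the point \<open>p\<close> form a subsheaf of the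
  terminal sheaf. It contains \<open>h U\<close> and all \<open>h V\<close> with \<open>V\<close> disjoint from \<open>U\<close>, but it is proper.\<close>

theorem not_strongly_positively_closed_hom_functor:
  assumes U: "U \<in> G" and p: "p \<in> T" "p \<notin> h U"
    and disj: "\<And>V. \<lbrakk>V \<in> G; V \<inter> U = {}\<rbrakk> \<Longrightarrow> p \<notin> h V"
  shows "\<not> strongly_positively_closed dom.Pos Sh
    (hom_functor :: ('b set, 'b set \<times> 'b set, ('a set, 'v) presheaf, ('a set, 'v) sheaf_arrow) fnctr)"
    (is "\<not> strongly_positively_closed _ _ ?M")
proof
  assume strong: "strongly_positively_closed dom.Pos Sh ?M"
  define J where "J = (ideal_sheaf {c. p \<notin> c} :: ('a set, 'v) presheaf)"
  have J: "sheaf J" "subterminal (set_poset F) J"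
    unfolding J_def using sheaf_ideal_sheaf[of "{c. p \<notin> c}"] subterminal_ideal_sheaf by blast+
  have Sec_J: "Sec J c = (if p \<in> c then {} else {undefined})" for c
    by (simp add: J_def)
  have US: "(U, S) \<in> subobjects dom.Pos S" "S \<in> Obj dom.Pos"
    using U dom.subset_top by (auto simp: dom.subobjects_Pos_iff)
  let ?I = "insert (on_arr ?M (U, S))
      (on_arr ?M ` {v \<in> subobjects dom.Pos S. disjoint_subobjects dom.Pos v (U, S)})"
  have "is_union Sh (on_obj ?M S) ?I (Idt Sh (on_obj ?M S))"
    using strong US unfolding strongly_positively_closed_def by blast
  then have union: "is_union Sh (rep T) ?I (Idt Sh (rep T))"
    by (simp only: on_obj_hom_functor hom_top)
  \<comment> \<open>Every element of \<open>F\<close> is below \<open>T\<close>, so \<open>J\<close>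
    maps to the terminal sheaf \<open>rep T\<close>; this arrow is the competing upper
    bound.\<close>
  obtain n where n: "n \<in> hom_set Sh J (rep T)"
    using hom_into_subterminal[OF subterminal_rep J(1) sheaf_rep, of T] subset_top
    by (auto simp: Sec_rep)
  have n_sub: "n \<in> subobjects Sh (rep T)"
    using is_mono_if_subterminal[OF n J(2)] n by (simp add: subobjects_def hom_set_def)
  have ft: "factors_through Sh (on_arr ?M v) n" if v: "v \<in> subobjects dom.Pos S" "p \<notin> h (fst v)" for v
  proof -
    have "on_arr ?M v \<in> hom_set Sh (rep (h (fst v))) (rep T)"
      using on_arr_hom_functor_hom[OF v(1)] hom_top by simp
    then show ?thesis
      using v(2) by (intro factors_through_subterminal[OF _ n] J subterminal_rep)
        (auto simp: Sec_rep Sec_J split: if_splits)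
  qed
  have "p \<notin> h (fst v)"
    if v: "v \<in> subobjects dom.Pos S" "disjoint_subobjects dom.Pos v (U, S)" for v
  proof -
    obtain a where a: "v = (a, S)" "a \<in> G"
      using v(1) dom.subobjects_Pos_iff by blast
    \<comment> \<open>The pullback of \<open>v\<close> and \<open>(U, S)\<close> has source
      \<open>a \<inter> U\<close>, and the union of no subobjects has source
      \<open>{}\<close>.\<close>
    have "a \<inter> U = {}"
      using v(2) unfolding a disjoint_subobjects_def
      by (auto simp: dom.is_pullback_Pos_iff dom.is_union_Pos_iff)
    then show ?thesis
      using disj a by simp
  qed
  then have "factors_through Sh s n" if "s \<in> ?I" for s
    using that ft US p(2) by auto
  \<comment> \<open>If the union is all of \<open>rep T\<close>, then \<open>J\<close> has a section
    over \<open>T\<close>, which contains \<open>p\<close>.\<close>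
  then have "factors_through Sh (Idt Sh (rep T)) n"
    using union n_sub unfolding is_union_def by blast
  moreover have "Src Sh (Idt Sh (rep T)) = rep T" "Src Sh n = J"
    using n by (auto simp: hom_set_def)
  ultimately have "Sec J T \<noteq> {}"
    using Sec_nonempty_if_factors_through[of "Idt Sh (rep T)" n T] by (simp add: Sec_rep)
  then show False
    using p(1) by (simp add: Sec_J)
qed

end

section \<open>Closed and clopen sets\<close>

text \<open>The interior of \<open>C\<close> is the complement of the closure of the open set
  \<open>topspace X - C\<close>, and this closure is open.\<close>

lemma closedin_interior_of:
  assumes "extremally_disconnected X" "closedin X C"
  shows "closedin X (X interior_of C)"
proof -
  have "openin X (X closure_of (topspace X - C))"
    using assms by (auto simp: extremally_disconnected_def)
  then show ?thesis
    unfolding interior_of_closure_of by blast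
qed

text \<open>Passing to complements, the claim is \<open>cl U \<inter> cl V \<subseteq> cl (U \<inter> V)\<close> for open \<open>U\<close> and \<open>V\<close>, which holds
  because \<open>cl U\<close> is open.\<close>

lemma interior_of_Un_closed:
  assumes X: "extremally_disconnected X" and CD: "closedin X C" "closedin X D"
  shows "X interior_of (C \<union> D) = X interior_of C \<union> X interior_of D"
proof
  define U V where "U = topspace X - C" and "V = topspace X - D"
  define P where "P = X closure_of U"
  have UV: "openin X U" "openin X V"
    using CD by (auto simp: U_def V_def)
  then have P: "openin X P"
    using X by (simp add: P_def extremally_disconnected_def)
  have "P \<inter> X closure_of V \<subseteq> X closure_of (P \<inter> V)"
    using openin_Int_closure_of_subset[OF P] .
  \<comment> \<open>\<open>U\<close> is dense in \<open>P\<close>: for open \<open>V\<close>,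
    closing \<open>U\<close> before intersecting does not change the closure of the
    intersection.\<close>
  also have "\<dots> = X closure_of (V \<inter> U)"
    using closure_of_openin_Int_closure_of[OF UV(2)] by (simp add: P_def inf_commute)
  finally have "X closure_of U \<inter> X closure_of V \<subseteq> X closure_of (topspace X - (C \<union> D))"
    by (simp add: P_def U_def V_def Int_commute Diff_Un)
  then show "X interior_of (C \<union> D) \<subseteq> X interior_of C \<union> X interior_of D"
    unfolding interior_of_closure_of[of X C] interior_of_closure_of[of X D]
      interior_of_closure_of[of X "C \<union> D"] U_def V_def by blast
qed (rule union_interior_of_subset)

text \<open>Extremal disconnectedness enters twice: interiors of closed sets are again closed, and
  interiors commute with binary unions of closed sets.\<close>

lemma interior_hom:
  assumes "extremally_disconnected X"
  shows "lattice_of_sets_hom {C. closedin X C} (topspace X) {C. closedin X C \<and> openin X C} (topspace X)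
    (\<lambda>C. X interior_of C)"
  by unfold_locales
    (auto simp: closedin_interior_of[OF assms] interior_of_Un_closed[OF assms] interior_of_Int
      dest: closedin_subset)

section \<open>Application to the interior homomorphism\<close>

lemma Closed_eq_set_poset: "Closed X = set_poset {C. closedin X C}"
  by (simp add: Closed_def set_poset_def)

lemma Clopen_eq_set_poset: "Clopen X = set_poset {C. closedin X C \<and> openin X C}"
  by (simp add: Clopen_def set_poset_def)

theorem mainTheorem4:
  fixes X :: "'a topology"
    and M :: "('a set, 'a set \<times> 'a set, ('a set, 'v) presheaf, ('a set, 'v) sheaf_arrow) fnctr"
  defines "M \<equiv> int_functor X"
  assumes "Stone_space X" and "extremally_disconnected X"
  shows "bounded_lattice_hom (Closed X) (Clopen X) (\<lambda>C. X interior_of C) \<and>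
    coherent_functor (poset_category (Closed X)) (Sh_Clopen X) M \<and>
    positively_closed (poset_category (Closed X)) (Sh_Clopen X) M \<and>
    (X \<noteq> discrete_topology (topspace X) \<longrightarrow>
      \<not> strongly_positively_closed (poset_category (Closed X)) (Sh_Clopen X) M)"
proof -
  interpret lattice_of_sets_hom "{C. closedin X C}" "topspace X"
    "{C. closedin X C \<and> openin X C}" "topspace X" "\<lambda>C. X interior_of C"
    by (rule interior_hom[OF assms(3)])
  have M: "M = hom_functor"
    unfolding M_def int_functor_def hom_functor_def Clopen_eq_set_poset by simp
  have "compact_space X" and Hausdorff: "Hausdorff_space X"
    using assms(2) by (auto simp: Stone_space_def)
  \<comment> \<open>Regularity provides the closed neighbourhoods that witness
    \<open>sep\<close>.\<close>
  then have "regular_space X"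
    by (simp add: compact_Hausdorff_imp_regular_space)
  then have nbhd: "neighbourhood_base_of (closedin X) X"
    by (simp add: neighbourhood_base_of_closedin)
  have sep: "\<exists>E\<in>{C. closedin X C}. E \<inter> C = {} \<and> X interior_of E \<inter> b \<noteq> {}"
    if C: "C \<in> {C. closedin X C}" and b: "b \<in> {C. closedin X C \<and> openin X C}"
      and not_le: "\<not> b \<subseteq> X interior_of C" for C b
  proof -
    \<comment> \<open>As \<open>b\<close> is open, \<open>b \<subseteq> C\<close> would already
      imply \<open>b \<subseteq> X interior_of C\<close>.\<close>
    have "\<not> b \<subseteq> C"
      using b not_le interior_of_maximal by blast
    then obtain x where x: "x \<in> b - C"
      by blast
    \<comment> \<open>Being open, \<open>b - C\<close> contains a closed neighbourhood
      \<open>E\<close> of \<open>x\<close>; it avoids \<open>C\<close>, while \<open>x\<close> lies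
      in its interior and in \<open>b\<close>.\<close>
    have "openin X (b - C)"
      using b C by (simp add: openin_diff)
    then obtain U E where UE: "openin X U" "closedin X E" "x \<in> U" "U \<subseteq> E" "E \<subseteq> b - C"
      using nbhd x unfolding neighbourhood_base_of by metis
    then have "x \<in> X interior_of E"
      using interior_of_maximal by blast
    then show ?thesis
      using UE x by blast
  qed
  have strong: "\<not> strongly_positively_closed (poset_category (Closed X)) (Sh_Clopen X) M"
    if not_discrete: "X \<noteq> discrete_topology (topspace X)"
  proof -
    \<comment> \<open>A point that is not isolated provides both the closed set \<open>{x}\<close>,
      whose interior misses \<open>x\<close>, and the point to be avoided by all the
      interiors.\<close>
    obtain x where x: "x \<in> topspace X" "\<not> openin X {x}"
      using not_discrete discrete_topology_unique by metis
    have "X interior_of {x} \<noteq> {x}"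
      using x by (simp add: interior_of_eq)
    then have "x \<notin> X interior_of {x}"
      using interior_of_subset by fastforce
    moreover have "closedin X {x}"
      using Hausdorff x by (simp add: closedin_Hausdorff_singleton)
    moreover have "x \<notin> X interior_of V" if "V \<inter> {x} = {}" for V
      using that interior_of_subset[of X V] by blast
    ultimately show ?thesis
      unfolding M Closed_eq_set_poset Clopen_eq_set_poset
      using x by (intro not_strongly_positively_closed_hom_functor[of "{x}" x]) auto
  qed
  show ?thesis
    using bounded_lattice_hom coherent_functor_hom_functor
      positively_closed_hom_functor[OF sep] strong
    unfolding M Closed_eq_set_poset Clopen_eq_set_poset by blast
qed

end
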